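(* Let $\mathcal{J}\subset\mathbb{R}\setminus\{0\}$ be a finite set, let $\lambda_j>0$ for $j\in\mathcal{J}$, and let $\{\mathcal{S}(s,t),\ (s,t)\in\mathbb{R}^2_+\}$ be the two-parameter generalized Skellam random field with parameters $\{\lambda_j\}_{j\in\mathcal{J}}$. For $l\ge1$, $l'\ge1$ and $k\ge1$, let $p_{l,l',j}^{(k)}\in(0,1)$ for all $j\in\mathcal{J}$ be such that $\sum_{j\in\mathcal{J}}p_{l,l',j}^{(k)}<1$. Let $\{\mathcal{X}_{l,l'}^{(k)}\}_{l\ge1,\,l'\ge1,\,k\ge1}$ be independent random variables such that $\mathcal{X}_{l,l'}^{(k)}$ takes the value $j$ with probability $p_{l,l',j}^{(k)}$ for each $j\in\mathcal{J}$, and the value $0$ with probability $1-\sum_{j\in\mathcal{J}}p_{l,l',j}^{(k)}$. Define $$\mathcal{Z}_k(s,t)=\sum_{l=1}^{[ks]}\sum_{l'=1}^{[kt]}\mathcal{X}_{l,l'}^{(k)},\quad (s,t)\in\mathbb{R}^2_+.$$ Suppose that for every $j\in\mathcal{J}$, as $k\to\infty$, $$\sum_{l=1}^{[ks]}\sum_{l'=1}^{[kt]}p_{l,l',j}^{(k)}\longrightarrow\lambda_j st\ \text{ for all }(s,t)\in\mathbb{R}^2_+,\qquad\text{and}\qquad \max_{1\le l\le k,\ 1\le l'\le k}p_{l,l',j}^{(k)}\longrightarrow0.$$ Then for every $m\ge1$ and all points $(s_r,t_r)\in\mathbb{R}^2_+$, $r=1,\dots,m$, with $(s_1,t_1)\preceq(s_2,t_2)\preceq\dots\preceq(s_m,t_m)$,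 $$(\mathcal{Z}_k(s_1,t_1),\mathcal{Z}_k(s_2,t_2),\dots,\mathcal{Z}_k(s_m,t_m))\longrightarrow(\mathcal{S}(s_1,t_1),\mathcal{S}(s_2,t_2),\dots,\mathcal{S}(s_m,t_m))$$ in distribution as $k\to\infty$.
   Context: $\mathbb{R}_+$ is the set of non-negative reals; $[x]$ denotes the integer part of $x$; $(s,t)\preceq(s',t')$ means $s\le s'$ and $t\le t'$. Empty sums are $0$. A Poisson random field (PRF) on $\mathbb{R}^2_+$ with parameter $\lambda>0$ is a non-negative integer-valued random measure $\{N(B)\}$ indexed by Borel sets $B\subseteq\mathbb{R}^2_+$ such that $N(B)$ is Poisson with mean $\lambda|B|$ whenever the Lebesgue measure $|B|$ is finite, and $N(B_1),\dots,N(B_n)$ are independent for disjoint $B_1,\dots,B_n$. One writes $N(s,t)=N([0,s]\times[0,t])$. The two-parameter generalized Skellam random field with parameters $\{\lambda_j\}_{j\in\mathcal{J}}$ is $\mathcal{S}(s,t)=\sum_{j\in\mathcal{J}}jN_j(s,t)$, where $\{N_j(s,t),\ (s,t)\in\mathbb{R}^2_+\}$, $j\in\mathcal{J}$, are independent PRFs with parameters $\lambda_j$ respectively. *)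

theory Defs
  imports "HOL-Probability.Probability"
begin

definition quadrant :: "(real \<times> real) set" where
  "quadrant = {0..} \<times> {0..}"

abbreviation quadrant_borel :: "(real \<times> real) measure" where
  "quadrant_borel \<equiv> restrict_space borel quadrant"

text \<open>
  A random measure is a function \<open>N\<close> from outcomes to measures on the Borel sets of the closed
  quadrant, with \<open>N(B)\<close> rendered as \<open>\<lambda>\<omega>. emeasure (N \<omega>) B\<close>; the value \<open>\<infinity>\<close> is allowed, since it
  is attained on sets of infinite Lebesgue measure. The Poisson probabilities are written out,
  because \<^const>\<open>poisson_pmf\<close> is specified for positive rates only, whereas Lebesgue null sets
  lead to rate 0 (point mass at 0).
\<close>

definition (in prob_space) poisson_random_field :: "real \<Rightarrow> ('a \<Rightarrow> (real \<times> real) measure) \<Rightarrow> bool"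
where
  "poisson_random_field lam N \<longleftrightarrow>
     lam > 0 \<and>
     (\<forall>\<omega>\<in>space M. sets (N \<omega>) = sets quadrant_borel) \<and>
     (\<forall>\<omega>\<in>space M. \<forall>B\<in>sets quadrant_borel. emeasure (N \<omega>) B \<in> range ennreal_of_enat) \<and>
     (\<forall>B\<in>sets quadrant_borel. (\<lambda>\<omega>. emeasure (N \<omega>) B) \<in> borel_measurable M) \<and>
     (\<forall>B\<in>sets quadrant_borel. emeasure lborel B < \<infinity> \<longrightarrow>
        (\<forall>n::nat. prob {\<omega>\<in>space M. emeasure (N \<omega>) B = of_nat n}
           = (lam * measure lborel B) ^ n / fact n * exp (- (lam * measure lborel B)))) \<and>
     (\<forall>(n::nat) B. disjoint_family_on B {1..n} \<and> B ` {1..n} \<subseteq> sets quadrant_borel \<longrightarrow>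
        indep_vars (\<lambda>_. borel) (\<lambda>i \<omega>. emeasure (N \<omega>) (B i)) {1..n})"

text \<open>
  The value of \<open>N\<close> at the point \<open>(s,t)\<close> is almost surely finite; \<^const>\<open>measure\<close> replaces a
  possible value \<open>\<infinity>\<close> on a null set by 0.
\<close>

definition rect_count :: "('a \<Rightarrow> (real \<times> real) measure) \<Rightarrow> real \<Rightarrow> real \<Rightarrow> 'a \<Rightarrow> real" where
  "rect_count N s t \<omega> = measure (N \<omega>) ({0..s} \<times> {0..t})"

text \<open>
  Independence of the fields means independence of the random elements
  \<open>{N\<^sub>j(s,t), (s,t) \<in> quadrant}\<close> of the product space \<open>\<real>\<close>-to-the-\<open>quadrant\<close>.
\<close>

definition (in prob_space) generalized_Skellam_field ::
  "real set \<Rightarrow> (real \<Rightarrow> real) \<Rightarrow> (real \<Rightarrow> real \<Rightarrow> 'a \<Rightarrow> real) \<Rightarrow> bool"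
where
  "generalized_Skellam_field J lam S \<longleftrightarrow>
     (\<exists>N. (\<forall>j\<in>J. poisson_random_field (lam j) (N j)) \<and>
          indep_vars (\<lambda>_. \<Pi>\<^sub>M z\<in>quadrant. borel)
            (\<lambda>j \<omega>. \<lambda>z\<in>quadrant. rect_count (N j) (fst z) (snd z) \<omega>) J \<and>
          (\<forall>s\<ge>0. \<forall>t\<ge>0. \<forall>\<omega>\<in>space M. S s t \<omega> = (\<Sum>j\<in>J. j * rect_count (N j) s t \<omega>)))"

definition weakly_converges :: "'b topology \<Rightarrow> (nat \<Rightarrow> 'b measure) \<Rightarrow> 'b measure \<Rightarrow> bool" where
  "weakly_converges T \<mu> \<nu> \<longleftrightarrow>
     (\<forall>f. continuous_map T euclideanreal f \<and> bounded (f ` topspace T) \<longrightarrow>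
        (\<lambda>k. \<integral>x. f x \<partial>\<mu> k) \<longlonglongrightarrow> (\<integral>x. f x \<partial>\<nu>))"

text \<open>
  Random vectors with \<open>m\<close> real components are functions on \<open>{1..m}\<close> (extensional outside), so
  that \<open>m\<close> is an ordinary natural number. The random vectors may live on different probability
  spaces.
\<close>

definition vector_law :: "nat \<Rightarrow> 'a measure \<Rightarrow> (nat \<Rightarrow> 'a \<Rightarrow> real) \<Rightarrow> (nat \<Rightarrow> real) measure" where
  "vector_law m M V = distr M (\<Pi>\<^sub>M r\<in>{1..m}. borel) (\<lambda>\<omega>. \<lambda>r\<in>{1..m}. V r \<omega>)"

definition vectors_converge_in_distribution ::
  "nat \<Rightarrow> 'a measure \<Rightarrow> (nat \<Rightarrow> nat \<Rightarrow> 'a \<Rightarrow> real) \<Rightarrow> 'b measure \<Rightarrow> (nat \<Rightarrow> 'b \<Rightarrow> real) \<Rightarrow> bool"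
where
  "vectors_converge_in_distribution m P V Q W \<longleftrightarrow>
     weakly_converges (product_topology (\<lambda>_. euclideanreal) {1..m})
       (\<lambda>k. vector_law m P (V k)) (vector_law m Q W)"

definition array_field ::
  "(nat \<Rightarrow> nat \<Rightarrow> nat \<Rightarrow> 'a \<Rightarrow> real) \<Rightarrow> nat \<Rightarrow> real \<Rightarrow> real \<Rightarrow> 'a \<Rightarrow> real"
where
  "array_field X k s t \<omega> =
     (\<Sum>l = 1..nat \<lfloor>real k * s\<rfloor>. \<Sum>l' = 1..nat \<lfloor>real k * t\<rfloor>. X k l l' \<omega>)"

end

theory Submission
  imports Defs "HOL-Library.Function_Algebras"
begin

text \<open>
  The proof is Le Cam's Poisson approximation in total variation, carried out for vectors. All the
  random vectors involved have discrete laws, so arguments with point masses suffice. Total variation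
  compares laws, whatever the probability spaces, and the errors add up under independent sums.

  Read the path values \<open>(Z\<^sub>k(s\<^sub>1,t\<^sub>1), \<dots>, Z\<^sub>k(s\<^sub>m,t\<^sub>m))\<close> as one sum over the cells \<open>(l,l')\<close> of the largest
  grid rectangle: a cell contributes its jump to every coordinate from the first rectangle that
  contains it onwards. Replacing the jump of a cell with probabilities \<open>p\<^sub>j\<close> by a sum of independent
  variables \<open>j \<cdot> Poisson(p\<^sub>j)\<close> costs at most \<open>2q\<^sup>2\<close> in total variation, where \<open>q = \<Sum>\<^sub>j p\<^sub>j\<close> (lemma
  \<open>le_cam_one_step\<close>). After this replacement, Poisson additivity merges all cells that
  first appear in the same rectangle, and the law becomes that of
  \<open>\<Sum>\<^sub>j \<Sum>\<^sub>r j \<cdot> Poisson(a\<^sub>k(j,r))\<close> placed on coordinates \<open>r, \<dots>, m\<close>, with \<open>a\<^sub>k(j,r)\<close> the sum of the \<open>p\<^sub>j\<close>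
  over the difference of consecutive rectangles (lemma \<open>le_cam_chain\<close>). The Skellam field along
  the path has exactly such a law, with rates \<open>\<lambda>\<^sub>j\<close> times the difference of the areas: a Poisson
  random field is independent on the disjoint differences of consecutive rectangles (lemma
  \<open>generalized_Skellam_field_path_law\<close>). The rates converge by hypothesis, and Poisson laws depend
  continuously on the rate.

  It remains to see that the total replacement error \<open>2 \<Sum> q\<^sup>2\<close> over the grid vanishes (lemma
  \<open>sum_squares_grid_tendsto_0\<close>). Cut the rectangle into \<open>n\<close> strips of equal width. Within a strip
  the sum of the squares is at most the square of the sum, which tends to \<open>(\<Lambda>st/n)\<^sup>2\<close> with
  \<open>\<Lambda> = \<Sum>\<^sub>j \<lambda>\<^sub>j\<close>; hence the limit superior is at most \<open>(\<Lambda>st)\<^sup>2/n\<close> for every \<open>n\<close>. This controls all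
  rectangles, including those that reach beyond the unit square.
\<close>

section \<open>Convolution of discrete laws\<close>

definition conv :: "'v::comm_monoid_add pmf \<Rightarrow> 'v pmf \<Rightarrow> 'v pmf" where
  "conv \<mu> \<nu> = bind_pmf \<mu> (\<lambda>x. map_pmf (\<lambda>y. x + y) \<nu>)"

text \<open>
  As a commutative monoid, convolution inherits the big-operator library: \<open>conv_family \<mu> I\<close>
  is the law of a sum of independent summands with laws \<open>\<mu> i\<close>, and regrouping independent sums is
  regrouping of a big operator.
\<close>

global_interpretation conv: comm_monoid_set conv "return_pmf 0"
  defines conv_family = conv.F
proof
  fix a b c :: "'v::comm_monoid_add pmf"
  show "conv (conv a b) c = conv a (conv b c)"
    by (simp add: conv_def map_pmf_def bind_assoc_pmf bind_return_pmf add.assoc)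
  show "conv a b = conv b a"
    unfolding conv_def map_pmf_def
    by (subst bind_commute_pmf) (simp add: add.commute)
  show "conv a (return_pmf 0) = a"
    by (simp add: conv_def map_pmf_def bind_return_pmf bind_return_pmf')
qed

lemma conv_eq_map_pair: "conv \<mu> \<nu> = map_pmf (\<lambda>(x, y). x + y) (pair_pmf \<mu> \<nu>)"
  by (simp add: conv_def pair_pmf_def map_pmf_def bind_assoc_pmf bind_return_pmf)

lemma map_pmf_conv:
  assumes "\<And>x y. h (x + y) = h x + h y"
  shows "map_pmf h (conv \<mu> \<nu>) = conv (map_pmf h \<mu>) (map_pmf h \<nu>)"
  by (simp add: conv_def map_pmf_def bind_assoc_pmf bind_return_pmf assms)

lemma map_pmf_conv_family:
  fixes h :: "'v::comm_monoid_add \<Rightarrow> 'w::comm_monoid_add"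
  assumes "\<And>x y. h (x + y) = h x + h y" and "h 0 = 0"
  shows "map_pmf h (conv_family \<mu> I) = conv_family (\<lambda>i. map_pmf h (\<mu> i)) I"
  by (induction I rule: infinite_finite_induct) (simp_all add: assms map_pmf_conv)

text \<open>
  This ties \<open>conv_family\<close> to the product law: it is the image of the product under summation.
\<close>

lemma map_sum_Pi_pmf:
  fixes \<phi> :: "'i \<Rightarrow> 'x \<Rightarrow> 'v::comm_monoid_add"
  assumes "finite I"
  shows "map_pmf (\<lambda>c. \<Sum>i\<in>I. \<phi> i (c i)) (Pi_pmf I d \<mu>) = conv_family (\<lambda>i. map_pmf (\<phi> i) (\<mu> i)) I"
  using assms
proof (induction I)
  case (insert a I)
  have *: "(\<Sum>i\<in>I. \<phi> i (if i = a then x else c i)) = (\<Sum>i\<in>I. \<phi> i (c i))" for x c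
    using insert by (intro sum.cong) auto
  show ?case
    using insert
    by (simp add: Pi_pmf_insert conv_eq_map_pair map_pmf_comp case_prod_beta fun_upd_def *
        flip: insert.IH) (simp add: pair_map_pmf1 pair_map_pmf2 map_pmf_comp case_prod_beta)
qed (simp add: zero_fun_def)

lemma pmf_map_ge: "pmf \<mu> x \<le> pmf (map_pmf h \<mu>) (h x)"
  unfolding pmf_map by (subst measure_pmf_single[symmetric], rule measure_pmf.finite_measure_mono) auto

lemma pmf_conv_ge:
  "pmf \<mu> x * pmf \<nu> y \<le> pmf (conv \<mu> \<nu>) (x + y)"
  using pmf_map_ge[of "pair_pmf \<mu> \<nu>" "(x, y)" "\<lambda>(x, y). x + y"]
  by (simp add: conv_eq_map_pair pmf_pair)

text \<open>
  One way of obtaining the value \<open>\<Sum>i. x i\<close> is that each summand equals its \<open>x i\<close>. Lower bounds of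
  this kind on point masses are all that the total variation estimates below require.
\<close>

lemma pmf_conv_family_ge:
  assumes "finite I"
  shows "(\<Prod>i\<in>I. pmf (\<mu> i) (x i)) \<le> pmf (conv_family \<mu> I) (\<Sum>i\<in>I. x i)"
  using assms
proof (induction I)
  case (insert a I)
  have "(\<Prod>i\<in>insert a I. pmf (\<mu> i) (x i)) = pmf (\<mu> a) (x a) * (\<Prod>i\<in>I. pmf (\<mu> i) (x i))"
    using insert by simp
  also have "\<dots> \<le> pmf (\<mu> a) (x a) * pmf (conv_family \<mu> I) (\<Sum>i\<in>I. x i)"
    by (intro mult_left_mono insert.IH) simp
  also have "\<dots> \<le> pmf (conv (\<mu> a) (conv_family \<mu> I)) (x a + (\<Sum>i\<in>I. x i))"
    by (rule pmf_conv_ge)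
  finally show ?case using insert by simp
qed (simp add: zero_fun_def)

section \<open>Total variation distance\<close>

text \<open>
  A bound on twice the usual total variation distance, in dual form: test functions may be arbitrary because
  every function is measurable for a probability mass function. The dual form makes the behaviour
  under images and convolutions immediate.
\<close>

definition tv_close :: "real \<Rightarrow> 'v pmf \<Rightarrow> 'v pmf \<Rightarrow> bool" where
  "tv_close \<epsilon> \<mu> \<nu> \<longleftrightarrow> (\<forall>f::'v \<Rightarrow> real. (\<forall>x. \<bar>f x\<bar> \<le> 1) \<longrightarrow>
     \<bar>measure_pmf.expectation \<mu> f - measure_pmf.expectation \<nu> f\<bar> \<le> \<epsilon>)"

lemma tv_close_refl: "tv_close 0 \<mu> \<mu>"
  by (simp add: tv_close_def)

lemma tv_close_sym: "tv_close \<epsilon> \<mu> \<nu> \<Longrightarrow> tv_close \<epsilon> \<nu> \<mu>"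
  by (simp add: tv_close_def abs_minus_commute)

lemma tv_close_trans:
  assumes "tv_close \<epsilon> \<mu> \<nu>" "tv_close \<delta> \<nu> \<rho>"
  shows "tv_close (\<epsilon> + \<delta>) \<mu> \<rho>"
  unfolding tv_close_def
proof (intro allI impI)
  fix f :: "'a \<Rightarrow> real" assume "\<forall>x. \<bar>f x\<bar> \<le> 1"
  then show "\<bar>measure_pmf.expectation \<mu> f - measure_pmf.expectation \<rho> f\<bar> \<le> \<epsilon> + \<delta>"
    using assms[unfolded tv_close_def, rule_format, of f] by auto
qed

lemma tv_close_map: "tv_close \<epsilon> \<mu> \<nu> \<Longrightarrow> tv_close \<epsilon> (map_pmf h \<mu>) (map_pmf h \<nu>)"
  by (simp add: tv_close_def)

lemma expectation_pmf_bounded: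
  fixes f :: "'a \<Rightarrow> real"
  assumes "\<And>x. \<bar>f x\<bar> \<le> C"
  shows "\<bar>measure_pmf.expectation \<mu> f\<bar> \<le> C"
proof -
  have int: "integrable (measure_pmf \<mu>) f"
    using assms by (intro measure_pmf.integrable_const_bound[where B=C]) auto
  have "f x \<le> C" "- C \<le> f x" for x using assms[of x] by auto
  then show ?thesis
    using measure_pmf.integral_le_const[OF int, of C] measure_pmf.integral_ge_const[OF int, of "- C"]
    by (simp add: abs_le_iff)
qed

lemma expectation_conv:
  fixes f :: "'v::comm_monoid_add \<Rightarrow> real"
  assumes "\<And>x. \<bar>f x\<bar> \<le> C"
  shows "measure_pmf.expectation (conv \<mu> \<nu>) f
    = measure_pmf.expectation \<mu> (\<lambda>x. measure_pmf.expectation \<nu> (\<lambda>y. f (x + y)))"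
  using measurable_measure_pmf[of "\<lambda>x. map_pmf ((+) x) \<nu>"]
  unfolding conv_def measure_pmf_bind
  by (subst integral_bind[where K = "count_space UNIV" and B = C and B' = 1])
     (auto simp: assms measure_pmf.finite_measure_axioms)

lemma tv_close_conv_left:
  assumes "tv_close \<epsilon> \<mu> \<mu>'"
  shows "tv_close \<epsilon> (conv \<mu> \<nu>) (conv \<mu>' \<nu>)"
  unfolding tv_close_def
proof (intro allI impI)
  fix f :: "'a \<Rightarrow> real" assume f: "\<forall>x. \<bar>f x\<bar> \<le> 1"
  have "\<bar>measure_pmf.expectation \<nu> (\<lambda>y. f (x + y))\<bar> \<le> 1" for x
    using f by (intro expectation_pmf_bounded) auto
  with assms show "\<bar>measure_pmf.expectation (conv \<mu> \<nu>) f - measure_pmf.expectation (conv \<mu>' \<nu>) f\<bar> \<le> \<epsilon>"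
    unfolding tv_close_def using f by (simp add: expectation_conv[where C=1])
qed

lemma tv_close_conv:
  assumes "tv_close \<epsilon> \<mu> \<mu>'" "tv_close \<delta> \<nu> \<nu>'"
  shows "tv_close (\<epsilon> + \<delta>) (conv \<mu> \<nu>) (conv \<mu>' \<nu>')"
proof (rule tv_close_trans[OF tv_close_conv_left[OF assms(1)]])
  show "tv_close \<delta> (conv \<mu>' \<nu>) (conv \<mu>' \<nu>')"
    using tv_close_conv_left[OF assms(2), of \<mu>'] by (simp add: conv.commute)
qed

lemma tv_close_conv_family:
  assumes "\<And>i. i \<in> I \<Longrightarrow> tv_close (\<epsilon> i) (\<mu> i) (\<nu> i)"
  shows "tv_close (\<Sum>i\<in>I. \<epsilon> i) (conv_family \<mu> I) (conv_family \<nu> I)"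
  using assms
  by (induction I rule: infinite_finite_induct) (auto intro: tv_close_refl tv_close_conv)

text \<open>
  Both laws have total mass 1, so mass that \<open>\<nu>\<close> has in excess of \<open>\<mu>\<close> must be balanced by mass that it
  lacks. Hence a one-sided bound on the point masses, on a set that carries \<open>\<mu>\<close>, suffices.
\<close>

lemma tv_close_of_pmf_ge:
  fixes \<mu> \<nu> :: "'v pmf"
  assumes A: "finite A" "set_pmf \<mu> \<subseteq> A"
    and \<epsilon>: "\<And>x. x \<in> A \<Longrightarrow> 0 \<le> \<epsilon> x" "\<And>x. x \<in> A \<Longrightarrow> pmf \<mu> x - \<epsilon> x \<le> pmf \<nu> x"
  shows "tv_close (2 * (\<Sum>x\<in>A. \<epsilon> x)) \<mu> \<nu>"
  unfolding tv_close_def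
proof (intro allI impI)
  fix f :: "'v \<Rightarrow> real" assume f: "\<forall>x. \<bar>f x\<bar> \<le> 1"
  have int: "integrable (measure_pmf \<nu>) g" if "\<And>x. \<bar>g x\<bar> \<le> 1" for g :: "'v \<Rightarrow> real"
    using that by (intro measure_pmf.integrable_const_bound[where B=1]) auto
  have 1: "measure_pmf.expectation \<mu> f = (\<Sum>x\<in>A. f x * pmf \<mu> x)"
    using A by (intro integral_measure_pmf_real) auto
  have 2: "measure_pmf.expectation \<nu> f = (\<Sum>x\<in>A. f x * pmf \<nu> x)
             + measure_pmf.expectation \<nu> (\<lambda>x. f x * indicator (- A) x)"
  proof -
    have "measure_pmf.expectation \<nu> f
        = measure_pmf.expectation \<nu> (\<lambda>x. f x * indicator A x + f x * indicator (- A) x)"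
      by (intro Bochner_Integration.integral_cong) (auto split: split_indicator)
    also have "\<dots> = measure_pmf.expectation \<nu> (\<lambda>x. f x * indicator A x)
         + measure_pmf.expectation \<nu> (\<lambda>x. f x * indicator (- A) x)"
      using f by (intro Bochner_Integration.integral_add int) (auto split: split_indicator)
    also have "measure_pmf.expectation \<nu> (\<lambda>x. f x * indicator A x) = (\<Sum>x\<in>A. (f x * indicator A x) * pmf \<nu> x)"
      using A by (intro integral_measure_pmf_real) (auto split: split_indicator_asm)
    also have "\<dots> = (\<Sum>x\<in>A. f x * pmf \<nu> x)" by (intro sum.cong) auto
    finally show ?thesis .
  qed
  have tail: "\<bar>measure_pmf.expectation \<nu> (\<lambda>x. f x * indicator (- A) x)\<bar> \<le> (\<Sum>x\<in>A. pmf \<mu> x - pmf \<nu> x)"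
  proof -
    have "\<bar>measure_pmf.expectation \<nu> (\<lambda>x. f x * indicator (- A) x)\<bar>
       \<le> measure_pmf.expectation \<nu> (\<lambda>x. \<bar>f x * indicator (- A) x\<bar>)"
      by (rule integral_abs_bound)
    also have "\<dots> \<le> measure_pmf.expectation \<nu> (indicator (- A))"
      using f by (intro integral_mono int) (auto split: split_indicator)
    also have "\<dots> = measure_pmf.prob \<nu> (- A)" by simp
    also have "\<dots> = 1 - (\<Sum>x\<in>A. pmf \<nu> x)"
      using A measure_pmf.prob_compl[of A \<nu>] by (simp add: Compl_eq_Diff_UNIV measure_measure_pmf_finite)
    also have "1 = (\<Sum>x\<in>A. pmf \<mu> x)" using A by (simp add: sum_pmf_eq_1)
    finally show ?thesis by (simp add: sum_subtractf)
  qed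
  \<comment> \<open>The excess of \<open>\<nu>\<close> outside \<open>A\<close> is distributed over the points of \<open>A\<close>, where it adds
     \<open>pmf \<mu> x - pmf \<nu> x\<close> to the absolute difference; as \<open>f\<close> is bounded by 1, the two
     together are at most 0 or twice the deficit at \<open>x\<close>.\<close>
  have "\<bar>measure_pmf.expectation \<mu> f - measure_pmf.expectation \<nu> f\<bar>
      = \<bar>(\<Sum>x\<in>A. f x * (pmf \<mu> x - pmf \<nu> x)) - measure_pmf.expectation \<nu> (\<lambda>x. f x * indicator (- A) x)\<bar>"
    unfolding 1 2 by (simp add: algebra_simps sum_subtractf)
  also have "\<dots> \<le> (\<Sum>x\<in>A. \<bar>f x * (pmf \<mu> x - pmf \<nu> x)\<bar>) + (\<Sum>x\<in>A. pmf \<mu> x - pmf \<nu> x)"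
    by (intro order_trans[OF abs_triangle_ineq4] add_mono tail sum_abs)
  also have "\<dots> = (\<Sum>x\<in>A. \<bar>f x * (pmf \<mu> x - pmf \<nu> x)\<bar> + (pmf \<mu> x - pmf \<nu> x))"
    by (simp add: sum.distrib)
  also have "\<dots> \<le> (\<Sum>x\<in>A. 2 * \<epsilon> x)"
  proof (rule sum_mono)
    fix x assume x: "x \<in> A"
    have "\<bar>f x * (pmf \<mu> x - pmf \<nu> x)\<bar> \<le> \<bar>pmf \<mu> x - pmf \<nu> x\<bar>"
      using f by (simp add: abs_mult mult_left_le_one_le)
    then show "\<bar>f x * (pmf \<mu> x - pmf \<nu> x)\<bar> + (pmf \<mu> x - pmf \<nu> x) \<le> 2 * \<epsilon> x"
      using \<epsilon>[OF x] by linarith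
  qed
  finally show "\<bar>measure_pmf.expectation \<mu> f - measure_pmf.expectation \<nu> f\<bar> \<le> 2 * (\<Sum>x\<in>A. \<epsilon> x)"
    by (simp add: sum_distrib_left)
qed

section \<open>Poisson approximation\<close>

text \<open>
  The rate 0, as the point mass at 0, has to be admitted: consecutive rectangles of a path may
  coincide, and a block of cells may be empty.
\<close>

definition poisson_law :: "real \<Rightarrow> nat pmf" where
  "poisson_law a = (if a > 0 then poisson_pmf a else return_pmf 0)"

lemma pmf_poisson_law: "a \<ge> 0 \<Longrightarrow> pmf (poisson_law a) n = a ^ n / fact n * exp (- a)"
  by (cases n) (auto simp: poisson_law_def indicator_def)

lemma conv_poisson_law:
  assumes "a \<ge> 0" "b \<ge> 0"
  shows "conv (poisson_law a) (poisson_law b) = poisson_law (a + b)"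
proof (rule pmf_eqI)
  fix n
  have shift: "pmf (map_pmf ((+) k) (poisson_law b)) n = (if k \<le> n then pmf (poisson_law b) (n - k) else 0)" for k
  proof (cases "k \<le> n")
    case True
    then have "pmf (map_pmf ((+) k) (poisson_law b)) (k + (n - k)) = pmf (poisson_law b) (n - k)"
      by (intro pmf_map_inj') simp
    with True show ?thesis by simp
  next
    case False
    then show ?thesis by (auto simp: pmf_eq_0_set_pmf)
  qed
  have "pmf (conv (poisson_law a) (poisson_law b)) n
     = measure_pmf.expectation (poisson_law a) (\<lambda>k. if k \<le> n then pmf (poisson_law b) (n - k) else 0)"
    by (simp add: conv_def pmf_bind shift)
  also have "\<dots> = (\<Sum>k\<le>n. (if k \<le> n then pmf (poisson_law b) (n - k) else 0) * pmf (poisson_law a) k)"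
    by (intro integral_measure_pmf_real) (auto split: if_splits)
  also have "\<dots> = (\<Sum>k\<le>n. (real (n choose k) * a ^ k * b ^ (n - k)) * (exp (- a - b) / fact n))"
    by (intro sum.cong refl)
       (simp add: pmf_poisson_law assms binomial_fact exp_diff exp_minus field_simps)
  also have "\<dots> = (a + b) ^ n * (exp (- a - b) / fact n)"
    by (subst binomial_ring) (simp only: sum_distrib_right)
  also have "\<dots> = pmf (poisson_law (a + b)) n"
    using assms by (simp add: pmf_poisson_law algebra_simps)
  finally show "pmf (conv (poisson_law a) (poisson_law b)) n = pmf (poisson_law (a + b)) n" .
qed

lemma conv_family_poisson_law:
  assumes "finite I" "\<And>i. i \<in> I \<Longrightarrow> a i \<ge> 0"
  shows "conv_family (\<lambda>i. poisson_law (a i)) I = poisson_law (\<Sum>i\<in>I. a i)"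
  using assms by (induction I) (simp_all add: conv_poisson_law sum_nonneg, simp add: poisson_law_def)

text \<open>
  For \<open>a \<le> b\<close>, a \<open>Poisson(b)\<close> variable is a \<open>Poisson(a)\<close> variable plus an independent
  \<open>Poisson(b - a)\<close> one, and the latter vanishes with probability \<open>exp (a - b) \<ge> 1 - (b - a)\<close>.
\<close>

lemma tv_close_poisson_law:
  assumes "a \<ge> 0" "b \<ge> 0"
  shows "tv_close (2 * \<bar>a - b\<bar>) (poisson_law a) (poisson_law b)"
proof -
  have *: "tv_close (2 * \<bar>a - b\<bar>) (poisson_law a) (poisson_law b)" if "0 \<le> a" "a \<le> b" for a b
  proof -
    have "1 - (b - a) \<le> exp (a - b)"
      using exp_ge_add_one_self[of "a - b"] by linarith
    then have "tv_close (2 * (\<Sum>x\<in>{0::nat}. b - a)) (return_pmf (0::nat)) (poisson_law (b - a))"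
      using that
      by (intro tv_close_of_pmf_ge[where A = "{0::nat}" and \<epsilon> = "\<lambda>_. b - a"]) (auto simp: pmf_poisson_law)
    from tv_close_conv_left[OF this, of "poisson_law a"] show ?thesis
      using that by (simp add: conv_poisson_law)
  qed
  show ?thesis
    using *[of a b] *[of b a] assms by (cases "a \<le> b") (auto simp: abs_minus_commute intro: tv_close_sym)
qed

text \<open>
  With \<open>q\<close> the probability of a nonzero jump, the compound Poisson law has mass at least
  \<open>exp (-q) \<ge> 1 - q\<close> at 0 (no Poisson variable jumps) and at least \<open>p\<^sub>j exp (-q) \<ge> p\<^sub>j - p\<^sub>j q\<close> at
  \<open>j\<close> (exactly one jump, of size \<open>j\<close>). So the deficits relative to \<open>\<mu>\<close> are \<open>0\<close> and \<open>p\<^sub>j q\<close>, with sum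
  \<open>q\<^sup>2\<close>.
\<close>

lemma le_cam_one_step:
  fixes J :: "real set" and \<mu> :: "real pmf"
  assumes J: "finite J" "0 \<notin> J" and \<mu>: "set_pmf \<mu> \<subseteq> insert 0 J"
  shows "tv_close (2 * (\<Sum>j\<in>J. pmf \<mu> j)\<^sup>2) \<mu>
           (conv_family (\<lambda>j. map_pmf (\<lambda>n. j * real n) (poisson_law (pmf \<mu> j))) J)"
proof -
  define q where "q = (\<Sum>j\<in>J. pmf \<mu> j)"
  define \<pi> where "\<pi> = conv_family (\<lambda>j. map_pmf (\<lambda>n. j * real n) (poisson_law (pmf \<mu> j))) J"
  have q0: "0 \<le> q" by (simp add: q_def sum_nonneg)
  have mu0: "pmf \<mu> 0 = 1 - q"
    using sum_pmf_eq_1[of "insert 0 J" \<mu>] J \<mu> by (simp add: q_def)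
  have ge: "(\<Prod>j\<in>J. pmf (poisson_law (pmf \<mu> j)) (n j)) \<le> pmf \<pi> (\<Sum>j\<in>J. j * real (n j))" for n
  proof -
    have "(\<Prod>j\<in>J. pmf (poisson_law (pmf \<mu> j)) (n j))
       \<le> (\<Prod>j\<in>J. pmf (map_pmf (\<lambda>n. j * real n) (poisson_law (pmf \<mu> j))) (j * real (n j)))"
      by (intro prod_mono conjI pmf_map_ge[where h = "\<lambda>n. _ * real n"]) auto
    also have "\<dots> \<le> pmf \<pi> (\<Sum>j\<in>J. j * real (n j))"
      unfolding \<pi>_def by (rule pmf_conv_family_ge[OF J(1)])
    finally show ?thesis .
  qed
  have pi0: "exp (- q) \<le> pmf \<pi> 0"
    using ge[of "\<lambda>_. 0"] by (simp add: pmf_poisson_law q_def exp_sum[OF J(1)] flip: sum_negf)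
  have pij: "pmf \<mu> j * exp (- q) \<le> pmf \<pi> j" if j: "j \<in> J" for j
  proof -
    have "(\<Prod>i\<in>J. pmf (poisson_law (pmf \<mu> i)) (if i = j then 1 else 0))
        = (\<Prod>i\<in>J. (if i = j then pmf \<mu> i else 1) * exp (- pmf \<mu> i))"
      by (intro prod.cong) (auto simp: pmf_poisson_law)
    also have "\<dots> = pmf \<mu> j * exp (- q)"
      using j J(1) by (simp add: prod.distrib prod.delta q_def exp_sum flip: sum_negf)
    finally have "pmf \<mu> j * exp (- q) \<le> pmf \<pi> (\<Sum>i\<in>J. i * real (if i = j then 1 else 0))"
      using ge[of "\<lambda>i. if i = j then 1 else 0"] by simp
    also have "(\<Sum>i\<in>J. i * real (if i = j then 1 else 0)) = j"
      using j J(1) by (simp add: if_distrib sum.delta cong: if_cong)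
    finally show ?thesis .
  qed
  have e: "1 - q \<le> exp (- q)" using exp_ge_add_one_self[of "- q"] by simp
  have "tv_close (2 * (\<Sum>x\<in>insert 0 J. if x = 0 then 0 else pmf \<mu> x * q)) \<mu> \<pi>"
  proof (rule tv_close_of_pmf_ge)
    fix x assume x: "x \<in> insert 0 J"
    show "pmf \<mu> x - (if x = 0 then 0 else pmf \<mu> x * q) \<le> pmf \<pi> x"
    proof (cases "x = 0")
      case True then show ?thesis using mu0 pi0 e by simp
    next
      case False
      have "pmf \<mu> x - pmf \<mu> x * q \<le> pmf \<mu> x * exp (- q)"
        using mult_left_mono[OF e, of "pmf \<mu> x"] by (simp add: algebra_simps)
      with False x pij[of x] show ?thesis by auto
    qed
  qed (use J \<mu> q0 in auto)
  also have "(\<Sum>x\<in>insert 0 J. if x = 0 then 0 else pmf \<mu> x * q) = (\<Sum>x\<in>J. pmf \<mu> x * q)"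
    using J by (simp add: sum.insert) (intro sum.cong, auto)
  also have "\<dots> = q\<^sup>2" by (simp add: q_def sum_distrib_right power2_eq_square)
  finally show ?thesis by (simp add: q_def \<pi>_def)
qed

section \<open>Discrete laws of random elements\<close>

text \<open>
  Only the point masses on the support are prescribed; as they sum to 1, the random element lies in
  the support almost surely. This avoids choosing a \<open>\<sigma>\<close>-algebra on the value type, and it applies to
  real variables that are discrete only up to a null set.
\<close>

definition (in prob_space) has_law :: "('a \<Rightarrow> 'v) \<Rightarrow> 'v pmf \<Rightarrow> bool" where
  "has_law Y \<mu> \<longleftrightarrow> (\<forall>x\<in>set_pmf \<mu>. {\<omega>\<in>space M. Y \<omega> = x} \<in> events \<and>
     prob {\<omega>\<in>space M. Y \<omega> = x} = pmf \<mu> x)"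

context prob_space
begin

lemma has_law_AE:
  assumes "has_law Y \<mu>"
  shows "AE \<omega> in M. Y \<omega> \<in> set_pmf \<mu>"
proof -
  let ?E = "\<lambda>x. {\<omega>\<in>space M. Y \<omega> = x}"
  have ev: "?E x \<in> events" "prob (?E x) = pmf \<mu> x" if "x \<in> set_pmf \<mu>" for x
    using assms that by (auto simp: has_law_def)
  have U: "(\<Union>x\<in>set_pmf \<mu>. ?E x) = {\<omega>\<in>space M. Y \<omega> \<in> set_pmf \<mu>}" by auto
  have meas: "{\<omega>\<in>space M. Y \<omega> \<in> set_pmf \<mu>} \<in> events"
    unfolding U[symmetric] by (intro sets.countable_UN'' ev) auto
  have "emeasure M {\<omega>\<in>space M. Y \<omega> \<in> set_pmf \<mu>} = (\<integral>\<^sup>+x. emeasure M (?E x) \<partial>count_space (set_pmf \<mu>))"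
    unfolding U[symmetric]
    by (rule emeasure_UN_countable) (auto simp: ev disjoint_family_on_def)
  also have "\<dots> = (\<integral>\<^sup>+x. pmf \<mu> x \<partial>count_space (set_pmf \<mu>))"
    by (intro nn_integral_cong) (simp add: ev emeasure_eq_measure)
  also have "\<dots> = emeasure (measure_pmf \<mu>) (set_pmf \<mu>)"
    by (rule nn_integral_pmf)
  also have "\<dots> = 1"
    by (rule measure_pmf.emeasure_eq_1_AE) (auto simp: AE_measure_pmf_iff)
  finally show ?thesis
    using meas by (simp add: emeasure_eq_measure prob_Collect_eq_1)
qed

lemma has_law_expectation:
  fixes f :: "'v \<Rightarrow> real"
  assumes law: "has_law Y \<mu>" and f[measurable]: "(\<lambda>\<omega>. f (Y \<omega>)) \<in> borel_measurable M"
  shows "expectation (\<lambda>\<omega>. f (Y \<omega>)) = measure_pmf.expectation \<mu> f"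
proof -
  obtain x0 where x0: "x0 \<in> set_pmf \<mu>" using set_pmf_not_empty[of \<mu>] by auto
  let ?E = "\<lambda>x. {\<omega>\<in>space M. Y \<omega> = x}"
  have ev: "?E x \<in> events" "prob (?E x) = pmf \<mu> x" if "x \<in> set_pmf \<mu>" for x
    using law that by (auto simp: has_law_def)
  note ae = has_law_AE[OF law]
  \<comment> \<open>Off its support, \<open>Y\<close> need not be measurable for the discrete \<open>\<sigma>\<close>-algebra; moving it to one atom
     there changes it on a null set only.\<close>
  define Y' where "Y' \<omega> = (if Y \<omega> \<in> set_pmf \<mu> then Y \<omega> else x0)" for \<omega>
  have evU: "{\<omega>\<in>space M. Y \<omega> \<in> set_pmf \<mu>} \<in> events"
  proof -
    have "{\<omega>\<in>space M. Y \<omega> \<in> set_pmf \<mu>} = (\<Union>x\<in>set_pmf \<mu>. ?E x)" by auto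
    also have "\<dots> \<in> events" by (intro sets.countable_UN'' ev) auto
    finally show ?thesis .
  qed
  have pre: "Y' -` {x} \<inter> space M \<in> events" if "x \<in> set_pmf \<mu>" for x
  proof -
    have "Y' -` {x} \<inter> space M = (if x = x0 then ?E x \<union> (space M - {\<omega>\<in>space M. Y \<omega> \<in> set_pmf \<mu>}) else ?E x)"
      using x0 that by (auto simp: Y'_def)
    then show ?thesis using ev that evU by auto
  qed
  have meas[measurable]: "Y' \<in> measurable M (count_space UNIV)"
  proof (rule measurableI)
    fix A
    have "Y' -` A \<inter> space M = (\<Union>x\<in>set_pmf \<mu> \<inter> A. Y' -` {x} \<inter> space M)"
      using x0 by (auto simp: Y'_def)
    also have "\<dots> \<in> events" by (intro sets.countable_UN'' pre) auto
    finally show "Y' -` A \<inter> space M \<in> events" .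
  qed simp
  have eqY: "AE \<omega> in M. Y' \<omega> = Y \<omega>" using ae by eventually_elim (simp add: Y'_def)
  have dist: "distr M (count_space UNIV) Y' = measure_pmf \<mu>"
  proof (rule measure_eqI_countable_AE[where \<Omega> = "set_pmf \<mu>"])
    show "AE x in distr M (count_space UNIV) Y'. x \<in> set_pmf \<mu>"
      by (subst AE_distr_iff) (auto simp: Y'_def x0)
    fix x assume x: "x \<in> set_pmf \<mu>"
    have "emeasure (distr M (count_space UNIV) Y') {x} = emeasure M (Y' -` {x} \<inter> space M)"
      by (simp add: emeasure_distr)
    also have "\<dots> = emeasure M (?E x)"
      using eqY by (intro emeasure_eq_AE pre[OF x] ev(1)[OF x]) (auto elim: eventually_mono)
    finally show "emeasure (distr M (count_space UNIV) Y') {x} = emeasure (measure_pmf \<mu>) {x}"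
      by (simp add: emeasure_eq_measure ev x emeasure_pmf_single)
  qed (auto simp: AE_measure_pmf_iff)
  have "expectation (\<lambda>\<omega>. f (Y \<omega>)) = expectation (\<lambda>\<omega>. f (Y' \<omega>))"
    using eqY measurable_compose[OF meas, of f borel]
    by (intro integral_cong_AE) (auto elim: eventually_mono)
  also have "\<dots> = (\<integral>x. f x \<partial>distr M (count_space UNIV) Y')"
    by (rule integral_distr[symmetric]) auto
  finally show ?thesis by (simp add: dist)
qed

lemma has_law_cong_AE:
  assumes "has_law Y \<mu>" "AE \<omega> in M. Y \<omega> = Y' \<omega>"
    and "\<And>x. {\<omega>\<in>space M. Y' \<omega> = x} \<in> events"
  shows "has_law Y' \<mu>"
  unfolding has_law_def
proof (intro ballI conjI assms(3))
  fix x assume x: "x \<in> set_pmf \<mu>"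
  have "prob {\<omega>\<in>space M. Y' \<omega> = x} = prob {\<omega>\<in>space M. Y \<omega> = x}"
    using assms x by (intro finite_measure_eq_AE) (auto simp: has_law_def elim: eventually_mono)
  then show "prob {\<omega>\<in>space M. Y' \<omega> = x} = pmf \<mu> x"
    using assms x by (simp add: has_law_def)
qed

lemma has_law_map:
  assumes "has_law Y \<mu>" and ev: "\<And>x. {\<omega>\<in>space M. h (Y \<omega>) = x} \<in> events"
  shows "has_law (\<lambda>\<omega>. h (Y \<omega>)) (map_pmf h \<mu>)"
  unfolding has_law_def
proof (intro ballI conjI ev)
  fix z
  have eq: "indicator {x. h x = z} (Y \<omega>) = (indicator {\<omega>\<in>space M. h (Y \<omega>) = z} \<omega> :: real)"
    if "\<omega> \<in> space M" for \<omega>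
    using that by (auto split: split_indicator)
  have "expectation (\<lambda>\<omega>. indicat_real {x. h x = z} (Y \<omega>))
      = measure_pmf.expectation \<mu> (indicat_real {x. h x = z})"
  proof (rule has_law_expectation[OF assms(1)])
    show "(\<lambda>\<omega>. indicat_real {x. h x = z} (Y \<omega>)) \<in> borel_measurable M"
      using borel_measurable_indicator[OF ev[of z]] by (simp add: eq cong: measurable_cong)
  qed
  moreover have "expectation (\<lambda>\<omega>. indicat_real {x. h x = z} (Y \<omega>)) = prob {\<omega>\<in>space M. h (Y \<omega>) = z}"
    by (simp add: eq ev cong: Bochner_Integration.integral_cong)
  ultimately show "prob {\<omega>\<in>space M. h (Y \<omega>) = z} = pmf (map_pmf h \<mu>) z"
    by (simp add: pmf_map vimage_def)
qed

text \<open>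
  Independence enters only through the joint point masses on the support, which determine the law of
  the whole family. The value type \<open>'x\<close> of the sources is arbitrary, so that the lemma serves for
  single jumps, for masses of a random measure and for whole path vectors.
\<close>

lemma has_law_sum_independent:
  fixes \<phi> :: "'i \<Rightarrow> 'x \<Rightarrow> 'v::comm_monoid_add"
  assumes I: "finite I"
    and law: "\<And>i. i \<in> I \<Longrightarrow> has_law (Y i) (\<mu> i)"
    and indep: "\<And>c. (\<And>i. i \<in> I \<Longrightarrow> c i \<in> set_pmf (\<mu> i)) \<Longrightarrow>
      prob {\<omega>\<in>space M. \<forall>i\<in>I. Y i \<omega> = c i} = (\<Prod>i\<in>I. prob {\<omega>\<in>space M. Y i \<omega> = c i})"
    and ev: "\<And>x. {\<omega>\<in>space M. (\<Sum>i\<in>I. \<phi> i (Y i \<omega>)) = x} \<in> events"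
  shows "has_law (\<lambda>\<omega>. \<Sum>i\<in>I. \<phi> i (Y i \<omega>)) (conv_family (\<lambda>i. map_pmf (\<phi> i) (\<mu> i)) I)"
proof -
  let ?Y = "\<lambda>\<omega> i. if i \<in> I then Y i \<omega> else undefined"
  have "has_law ?Y (Pi_pmf I undefined \<mu>)"
    unfolding has_law_def
  proof (intro ballI)
    fix c assume "c \<in> set_pmf (Pi_pmf I undefined \<mu>)"
    then have "c \<in> PiE_dflt I undefined (set_pmf \<circ> \<mu>)"
      using I by (simp add: set_Pi_pmf)
    then have c: "\<And>i. i \<in> I \<Longrightarrow> c i \<in> set_pmf (\<mu> i)"
      and out: "\<And>i. i \<notin> I \<Longrightarrow> c i = undefined"
      by (auto simp: PiE_dflt_def)
    have eq: "{\<omega>\<in>space M. ?Y \<omega> = c} = {\<omega>\<in>space M. \<forall>i\<in>I. Y i \<omega> = c i}"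
      using out by (auto simp: fun_eq_iff)
    have "{\<omega>\<in>space M. \<forall>i\<in>I. Y i \<omega> = c i} \<in> events"
      using law c I by (intro sets.sets_Collect_finite_All) (auto simp: has_law_def)
    moreover have "prob {\<omega>\<in>space M. \<forall>i\<in>I. Y i \<omega> = c i} = (\<Prod>i\<in>I. pmf (\<mu> i) (c i))"
      using indep[OF c] law c by (simp add: has_law_def)
    ultimately show "{\<omega>\<in>space M. ?Y \<omega> = c} \<in> events \<and>
        prob {\<omega>\<in>space M. ?Y \<omega> = c} = pmf (Pi_pmf I undefined \<mu>) c"
      using out I by (simp add: eq pmf_Pi')
  qed
  from has_law_map[OF this, of "\<lambda>c. \<Sum>i\<in>I. \<phi> i (c i)"] show ?thesis
    using ev I by (simp add: map_sum_Pi_pmf)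
qed

lemma indep_vars_point_prob:
  assumes ind: "indep_vars (\<lambda>_. N) Y I" and fin: "finite I"
    and c: "\<And>i. i \<in> I \<Longrightarrow> A i \<in> sets N"
  shows "prob {\<omega>\<in>space M. \<forall>i\<in>I. Y i \<omega> \<in> A i} = (\<Prod>i\<in>I. prob {\<omega>\<in>space M. Y i \<omega> \<in> A i})"
proof (cases "I = {}")
  case True then show ?thesis by (simp add: prob_space)
next
  case False
  have "{\<omega>\<in>space M. \<forall>i\<in>I. Y i \<omega> \<in> A i} = (\<Inter>i\<in>I. Y i -` A i \<inter> space M)" using False by auto
  moreover have "{\<omega>\<in>space M. Y i \<omega> \<in> A i} = Y i -` A i \<inter> space M" for i by auto
  ultimately show ?thesis using indep_varsD_finite[OF ind False fin c] by simp
qed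

end

text \<open>
  Vectors indexed by \<open>{1..m}\<close> are represented as functions on all of \<open>nat\<close> that vanish elsewhere, so
  that they add pointwise; an equation between two of them is a finite conjunction of real equations.
\<close>

lemma event_function_eq:
  fixes V :: "nat \<Rightarrow> 'a \<Rightarrow> real"
  assumes "\<And>r. r \<in> {1..m} \<Longrightarrow> V r \<in> borel_measurable M" and "\<And>r \<omega>. r \<notin> {1..m} \<Longrightarrow> V r \<omega> = 0"
  shows "{\<omega>\<in>space M. (\<lambda>r. V r \<omega>) = x} \<in> sets M"
proof (cases "\<forall>r. r \<notin> {1..m} \<longrightarrow> x r = 0")
  case True
  then have "{\<omega>\<in>space M. (\<lambda>r. V r \<omega>) = x} = {\<omega>\<in>space M. \<forall>r\<in>{1..m}. V r \<omega> = x r}"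
    using assms(2) by (auto simp: fun_eq_iff)
  also have "\<dots> \<in> sets M"
    using assms(1) by (intro sets.sets_Collect_finite_All) auto
  finally show ?thesis .
next
  case False
  then obtain r where "r \<notin> {1..m}" "x r \<noteq> 0" by blast
  then have "V r \<omega> \<noteq> x r" for \<omega> using assms(2)[of r \<omega>] by simp
  then have "{\<omega>\<in>space M. (\<lambda>r. V r \<omega>) = x} = {}" by (auto simp: fun_eq_iff)
  then show ?thesis by (simp only: sets.empty_sets)
qed

section \<open>Jumps along an increasing chain of sets\<close>

lemma sum_fun_apply: "(\<Sum>i\<in>A. f i) x = (\<Sum>i\<in>A. f i x)"
  for f :: "'i \<Rightarrow> 'a \<Rightarrow> 'b::comm_monoid_add"
  by (induction A rule: infinite_finite_induct) auto

text \<open>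
  The effect on the path vector of a jump \<open>x\<close> in the \<open>r\<close>-th block: all later sets of the chain contain
  that block.
\<close>

definition tail_vector :: "nat \<Rightarrow> nat \<Rightarrow> real \<Rightarrow> nat \<Rightarrow> real" where
  "tail_vector m r x = (\<lambda>r'. if r \<le> r' \<and> r' \<le> m then x else 0)"

lemma tail_vector_add: "tail_vector m r (x + y) = tail_vector m r x + tail_vector m r y"
  by (auto simp: tail_vector_def fun_eq_iff)

lemma tail_vector_0: "tail_vector m r 0 = 0"
  by (auto simp: tail_vector_def fun_eq_iff)

lemma sum_tail_vector:
  fixes g :: "nat \<Rightarrow> real"
  shows "(\<Sum>r\<in>{1..m}. tail_vector m r (g r)) r' = (if r' \<in> {1..m} then \<Sum>r\<in>{1..r'}. g r else 0)"
proof (cases "r' \<in> {1..m}")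
  case True
  have "(\<Sum>r\<in>{1..m}. tail_vector m r (g r) r') = (\<Sum>r\<in>{1..r'}. g r)"
    using True by (intro sum.mono_neutral_cong_right) (auto simp: tail_vector_def)
  then show ?thesis using True by (simp add: sum_fun_apply)
next
  case False
  then show ?thesis unfolding sum_fun_apply
    by (auto simp: tail_vector_def intro!: sum.neutral)
qed

definition block :: "(nat \<Rightarrow> 'i set) \<Rightarrow> nat \<Rightarrow> 'i set" where
  "block R r = R r - R (r - 1)"

text \<open>
  The chain starts with the empty set at index 0, so that the first block is \<open>R 1\<close> itself.
\<close>

definition increasing_chain :: "nat \<Rightarrow> (nat \<Rightarrow> 'i set) \<Rightarrow> bool" where
  "increasing_chain m R \<longleftrightarrow> R 0 = {} \<and> (\<forall>r\<in>{1..m}. R (r - 1) \<subseteq> R r)"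

lemma chain_mono:
  assumes "increasing_chain m R" and "r \<le> r'" "r' \<le> m"
  shows "R r \<subseteq> R r'"
  using assms(2,3)
proof (induction r' rule: dec_induct)
  case (step n)
  then have "R n \<subseteq> R (Suc n)"
    using bspec[of "{1..m}" _ "Suc n"] assms(1) unfolding increasing_chain_def by fastforce
  with step show ?case by auto
qed simp

lemma disjoint_block:
  assumes "increasing_chain m R"
  shows "disjoint_family_on (block R) {1..m}"
proof -
  have *: "block R i \<inter> block R j = {}" if "i < j" "j \<le> m" for i j
  proof -
    have "R i \<subseteq> R (j - 1)" using that by (intro chain_mono[OF assms]) auto
    then show ?thesis by (auto simp: block_def)
  qed
  then show ?thesis
    unfolding disjoint_family_on_def by (metis Int_commute atLeastAtMost_iff linorder_neqE_nat)
qed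

lemma UN_block:
  assumes "increasing_chain m R" and "r \<le> m"
  shows "(\<Union>r'\<in>{1..r}. block R r') = R r"
  using assms(2)
proof (induction r)
  case (Suc r)
  have "(\<Union>r'\<in>{1..Suc r}. block R r') = (\<Union>r'\<in>{1..r}. block R r') \<union> block R (Suc r)"
    by (auto simp: atLeastAtMostSuc_conv)
  moreover have "R r \<subseteq> R (Suc r)" using chain_mono[OF assms(1), of r "Suc r"] Suc by simp
  ultimately show ?case using Suc by (auto simp: block_def)
qed (use assms in \<open>simp add: increasing_chain_def\<close>)

text \<open>
  The common form of the limit law and of its approximations: for each jump size \<open>j\<close> and each block
  \<open>r\<close> there is an independent Poisson number, with rate \<open>a j r\<close>, of jumps of size \<open>j\<close> in block \<open>r\<close>.
\<close>

definition chain_law :: "real set \<Rightarrow> nat \<Rightarrow> (real \<Rightarrow> nat \<Rightarrow> real) \<Rightarrow> (nat \<Rightarrow> real) pmf" where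
  "chain_law J m a = conv_family (\<lambda>j. conv_family (\<lambda>r.
     map_pmf (\<lambda>n. tail_vector m r (j * real n)) (poisson_law (a j r))) {1..m}) J"

lemma tv_close_chain_law:
  assumes "\<And>j r. j \<in> J \<Longrightarrow> r \<in> {1..m} \<Longrightarrow> a j r \<ge> 0 \<and> b j r \<ge> 0"
  shows "tv_close (\<Sum>j\<in>J. \<Sum>r\<in>{1..m}. 2 * \<bar>a j r - b j r\<bar>) (chain_law J m a) (chain_law J m b)"
  unfolding chain_law_def
  by (intro tv_close_conv_family tv_close_map tv_close_poisson_law) (auto simp: assms)

text \<open>
  The contribution of a single index \<open>i\<close>, written in terms of the sets of the chain. It agrees with
  \<open>tail_vector\<close> for the block that contains \<open>i\<close>, but it needs no reference to that block.
\<close>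

definition membership_vector :: "nat \<Rightarrow> (nat \<Rightarrow> 'i set) \<Rightarrow> 'i \<Rightarrow> real \<Rightarrow> nat \<Rightarrow> real" where
  "membership_vector m R i x = (\<lambda>r. if r \<in> {1..m} \<and> i \<in> R r then x else 0)"

lemma membership_vector_block:
  assumes "increasing_chain m R" and "r \<in> {1..m}" "i \<in> block R r"
  shows "membership_vector m R i = tail_vector m r"
proof -
  have "i \<in> R r' \<longleftrightarrow> r \<le> r'" if "r' \<in> {1..m}" for r'
  proof (cases "r \<le> r'")
    case True
    then show ?thesis
      using chain_mono[OF assms(1), of r r'] that assms(3) by (auto simp: block_def)
  next
    case False
    then have "R r' \<subseteq> R (r - 1)" using assms(2) by (intro chain_mono[OF assms(1)]) auto
    then show ?thesis using False assms(3) by (auto simp: block_def)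
  qed
  then show ?thesis using assms(2)
    by (fastforce simp: membership_vector_def tail_vector_def fun_eq_iff)
qed

lemma membership_vector_add:
  "membership_vector m R i (x + y) = membership_vector m R i x + membership_vector m R i y"
  by (auto simp: membership_vector_def fun_eq_iff)

lemma membership_vector_0: "membership_vector m R i 0 = 0"
  by (auto simp: membership_vector_def fun_eq_iff)

lemma sum_membership_vector:
  assumes "increasing_chain m R" "finite (R m)"
  shows "(\<Sum>i\<in>R m. membership_vector m R i (x i)) r = (if r \<in> {1..m} then \<Sum>i\<in>R r. x i else 0)"
proof (cases "r \<in> {1..m}")
  case True
  have "(\<Sum>i\<in>R m. membership_vector m R i (x i) r) = (\<Sum>i\<in>R r. x i)"
    using True assms(2) chain_mono[OF assms(1), of r m]
    by (intro sum.mono_neutral_cong_right) (auto simp: membership_vector_def)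
  then show ?thesis using True by (simp add: sum_fun_apply)
next
  case False
  then show ?thesis unfolding sum_fun_apply
    by (auto simp: membership_vector_def intro!: sum.neutral)
qed

text \<open>
  Apply the one-step bound to every index, exchange the sums over indices and jump sizes, and collect
  the indices block by block: within a block the contributions differ only in their Poisson
  numbers, which add up.
\<close>

lemma le_cam_chain:
  fixes R :: "nat \<Rightarrow> 'i set" and \<xi> :: "'i \<Rightarrow> real pmf"
  assumes chain: "increasing_chain m R" and fin: "finite (R m)"
    and J: "finite J" "0 \<notin> J" and \<xi>: "\<And>i. i \<in> R m \<Longrightarrow> set_pmf (\<xi> i) \<subseteq> insert 0 J"
  shows "tv_close (\<Sum>i\<in>R m. 2 * (\<Sum>j\<in>J. pmf (\<xi> i) j)\<^sup>2)
           (conv_family (\<lambda>i. map_pmf (membership_vector m R i) (\<xi> i)) (R m))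
           (chain_law J m (\<lambda>j r. \<Sum>i\<in>block R r. pmf (\<xi> i) j))"
proof -
  let ?P = "\<lambda>i j. map_pmf (\<lambda>n. membership_vector m R i (j * real n)) (poisson_law (pmf (\<xi> i) j))"
  have "tv_close (\<Sum>i\<in>R m. 2 * (\<Sum>j\<in>J. pmf (\<xi> i) j)\<^sup>2)
           (conv_family (\<lambda>i. map_pmf (membership_vector m R i) (\<xi> i)) (R m))
           (conv_family (\<lambda>i. map_pmf (membership_vector m R i)
             (conv_family (\<lambda>j. map_pmf (\<lambda>n. j * real n) (poisson_law (pmf (\<xi> i) j))) J)) (R m))"
    by (intro tv_close_conv_family tv_close_map le_cam_one_step J \<xi>)
  also have "(\<lambda>i. map_pmf (membership_vector m R i)
        (conv_family (\<lambda>j. map_pmf (\<lambda>n. j * real n) (poisson_law (pmf (\<xi> i) j))) J))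
      = (\<lambda>i. conv_family (?P i) J)"
    by (subst map_pmf_conv_family) (simp_all add: membership_vector_add membership_vector_0 map_pmf_comp)
  also have "conv_family (\<lambda>i. conv_family (?P i) J) (R m) = conv_family (\<lambda>j. conv_family (\<lambda>i. ?P i j) (R m)) J"
    by (rule conv.swap)
  also have "\<dots> = chain_law J m (\<lambda>j r. \<Sum>i\<in>block R r. pmf (\<xi> i) j)"
    unfolding chain_law_def
  proof (rule conv.cong[OF refl])
    fix j
    have finb: "finite (block R r)" if "r \<in> {1..m}" for r
      using fin chain_mono[OF chain, of r m] that by (auto simp: block_def intro: finite_subset)
    have "conv_family (\<lambda>i. ?P i j) (R m) = conv_family (\<lambda>i. ?P i j) (\<Union>r\<in>{1..m}. block R r)"
      using UN_block[OF chain, of m] by simp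
    also have "\<dots> = conv_family (\<lambda>r. conv_family (\<lambda>i. ?P i j) (block R r)) {1..m}"
      using disjoint_block[OF chain] finb
      by (intro conv.UNION_disjoint) (auto simp: disjoint_family_on_def)
    also have "\<dots> = conv_family (\<lambda>r. map_pmf (\<lambda>n. tail_vector m r (j * real n))
        (poisson_law (\<Sum>i\<in>block R r. pmf (\<xi> i) j))) {1..m}"
    proof (rule conv.cong[OF refl])
      fix r assume r: "r \<in> {1..m}"
      have "conv_family (\<lambda>i. ?P i j) (block R r)
          = conv_family (\<lambda>i. map_pmf (\<lambda>n. tail_vector m r (j * real n)) (poisson_law (pmf (\<xi> i) j))) (block R r)"
        using membership_vector_block[OF chain r] by (intro conv.cong) auto
      also have "\<dots> = map_pmf (\<lambda>n. tail_vector m r (j * real n)) (poisson_law (\<Sum>i\<in>block R r. pmf (\<xi> i) j))"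
        using finb[OF r] by (subst map_pmf_conv_family[symmetric])
          (simp_all add: algebra_simps tail_vector_add tail_vector_0 conv_family_poisson_law)
      finally show "conv_family (\<lambda>i. ?P i j) (block R r) = \<dots>" .
    qed
    finally show "conv_family (\<lambda>i. ?P i j) (R m) = \<dots>" .
  qed
  finally show ?thesis .
qed

section \<open>Grid rectangles and the null-array property\<close>

definition grid :: "nat \<Rightarrow> real \<Rightarrow> real \<Rightarrow> (nat \<times> nat) set" where
  "grid k u v = {1..nat \<lfloor>real k * u\<rfloor>} \<times> {1..nat \<lfloor>real k * v\<rfloor>}"

lemma finite_grid: "finite (grid k u v)"
  by (simp add: grid_def)

lemma grid_mono: "u \<le> u' \<Longrightarrow> v \<le> v' \<Longrightarrow> grid k u v \<subseteq> grid k u' v'"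
proof -
  have "nat \<lfloor>real k * a\<rfloor> \<le> nat \<lfloor>real k * b\<rfloor>" if "a \<le> b" for a b
    using that by (intro nat_mono floor_mono mult_left_mono) auto
  then show "u \<le> u' \<Longrightarrow> v \<le> v' \<Longrightarrow> ?thesis" unfolding grid_def by (intro Sigma_mono) auto
qed

lemma sum_squares_le_square_sum:
  fixes f :: "'i \<Rightarrow> real"
  assumes "finite A" "\<And>i. i \<in> A \<Longrightarrow> f i \<ge> 0"
  shows "(\<Sum>i\<in>A. (f i)\<^sup>2) \<le> (\<Sum>i\<in>A. f i)\<^sup>2"
proof -
  have "(\<Sum>i\<in>A. (f i)\<^sup>2) \<le> (\<Sum>i\<in>A. f i * (\<Sum>i\<in>A. f i))"
    unfolding power2_eq_square using assms
    by (intro sum_mono mult_left_mono member_le_sum) auto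
  then show ?thesis by (simp add: power2_eq_square sum_distrib_right)
qed

text \<open>
  Convergence of the rectangle sums to a multiple of the area forbids large single terms: a thin
  strip has a small limit, and it bounds each of its terms. Slicing in the first coordinate only is
  enough, since \<open>n\<close> strips with sums of order \<open>1/n\<close> have squares of total order \<open>1/n\<close>.
\<close>

lemma sum_squares_grid_tendsto_0:
  fixes q :: "nat \<Rightarrow> nat \<times> nat \<Rightarrow> real"
  assumes nonneg: "\<And>k i. k \<ge> 1 \<Longrightarrow> i \<in> {1..} \<times> {1..} \<Longrightarrow> q k i \<ge> 0"
    and lim: "\<And>u v. u \<ge> 0 \<Longrightarrow> v \<ge> 0 \<Longrightarrow> (\<lambda>k. \<Sum>i\<in>grid k u v. q k i) \<longlonglongrightarrow> c * u * v"
    and u: "u \<ge> 0" and v: "v \<ge> 0"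
  shows "(\<lambda>k. \<Sum>i\<in>grid k u v. (q k i)\<^sup>2) \<longlonglongrightarrow> 0"
proof (rule tendstoI)
  fix e :: real assume e: "e > 0"
  obtain n :: nat where n: "n > 0" "(c * u * v)\<^sup>2 / n < e"
  proof -
    obtain n0 :: nat where "(c * u * v)\<^sup>2 / e < n0" using reals_Archimedean2 by blast
    then have "(c * u * v)\<^sup>2 < e * Suc n0"
      using e by (simp add: field_simps)
    then show ?thesis by (intro that[of "Suc n0"]) (simp_all add: field_simps)
  qed
  define x where "x a = real a * u / real n" for a :: nat
  have x: "x a \<ge> 0" "x a \<le> x (Suc a)" "x 0 = 0" "x n = u" for a
    using u n by (auto simp: x_def divide_right_mono mult_right_mono)
  define F where "F k a = (\<Sum>i\<in>grid k (x a) v. q k i)" for k a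
  define G where "G k a = (\<Sum>i\<in>grid k (x a) v. (q k i)\<^sup>2)" for k a
  have "(\<lambda>k. \<Sum>a<n. (F k (Suc a) - F k a)\<^sup>2) \<longlonglongrightarrow> (\<Sum>a<n. (c * x (Suc a) * v - c * x a * v)\<^sup>2)"
    unfolding F_def using x v by (intro tendsto_intros lim) auto
  moreover have "(\<Sum>a<n. (c * x (Suc a) * v - c * x a * v)\<^sup>2) = (c * u * v)\<^sup>2 / n"
  proof -
    have "c * x (Suc a) * v - c * x a * v = c * u * v / n" for a
      using n by (simp add: x_def field_simps)
    then show ?thesis using n by (simp add: power_divide power2_eq_square)
  qed
  ultimately have ev: "\<forall>\<^sub>F k in sequentially. (\<Sum>a<n. (F k (Suc a) - F k a)\<^sup>2) < e"
    using n by (intro order_tendstoD(2)) auto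
  \<comment> \<open>The sum of squares \<open>G k n\<close> telescopes over the strips, and the increment of \<open>G k\<close> over a strip is a sum
     of squares of terms whose sum is the increment of \<open>F k\<close>.\<close>
  have "G k n \<le> (\<Sum>a<n. (F k (Suc a) - F k a)\<^sup>2)" if k: "k \<ge> 1" for k
  proof -
    have "G k n = (\<Sum>a<n. G k (Suc a) - G k a)"
      by (subst sum_lessThan_telescope) (simp add: G_def x grid_def)
    also have "\<dots> \<le> (\<Sum>a<n. (F k (Suc a) - F k a)\<^sup>2)"
    proof (rule sum_mono)
      fix a
      let ?D = "grid k (x (Suc a)) v - grid k (x a) v"
      have sub: "grid k (x a) v \<subseteq> grid k (x (Suc a)) v" using x by (intro grid_mono) auto
      have "G k (Suc a) - G k a = (\<Sum>i\<in>?D. (q k i)\<^sup>2)"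
        unfolding G_def by (simp add: sum_diff finite_grid sub)
      also have "\<dots> \<le> (\<Sum>i\<in>?D. q k i)\<^sup>2"
        using k by (intro sum_squares_le_square_sum nonneg) (auto simp: finite_grid, auto simp: grid_def)
      also have "(\<Sum>i\<in>?D. q k i) = F k (Suc a) - F k a"
        unfolding F_def by (simp add: sum_diff finite_grid sub)
      finally show "G k (Suc a) - G k a \<le> (F k (Suc a) - F k a)\<^sup>2" .
    qed
    finally show ?thesis .
  qed
  then have "\<forall>\<^sub>F k in sequentially. G k n \<le> (\<Sum>a<n. (F k (Suc a) - F k a)\<^sup>2)"
    by (intro eventually_sequentiallyI[of 1])
  with ev show "\<forall>\<^sub>F k in sequentially. dist (\<Sum>i\<in>grid k u v. (q k i)\<^sup>2) 0 < e"
    by eventually_elim (simp add: G_def x sum_nonneg)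
qed

section \<open>The Skellam field along a monotone path\<close>

text \<open>
  The index 0 stands for the empty rectangle, as required of an increasing chain, whatever the
  values of \<open>s\<close> and \<open>t\<close> at 0 are.
\<close>

definition rectangle :: "(nat \<Rightarrow> real) \<Rightarrow> (nat \<Rightarrow> real) \<Rightarrow> nat \<Rightarrow> (real \<times> real) set" where
  "rectangle s t r = (if r = 0 then {} else {0..s r} \<times> {0..t r})"

definition area :: "(nat \<Rightarrow> real) \<Rightarrow> (nat \<Rightarrow> real) \<Rightarrow> nat \<Rightarrow> real" where
  "area s t r = (if r = 0 then 0 else s r * t r)"

definition monotone_path :: "nat \<Rightarrow> (nat \<Rightarrow> real) \<Rightarrow> (nat \<Rightarrow> real) \<Rightarrow> bool" where
  "monotone_path m s t \<longleftrightarrow> (\<forall>r\<in>{1..m}. s r \<ge> 0 \<and> t r \<ge> 0) \<and>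
     (\<forall>r\<in>{1..<m}. s r \<le> s (Suc r) \<and> t r \<le> t (Suc r))"

lemma monotone_path_step:
  assumes "monotone_path m s t" "r \<in> {1..m}" "r \<noteq> 1"
  shows "s (r - 1) \<le> s r \<and> t (r - 1) \<le> t r"
proof -
  have "r - 1 \<in> {1..<m}" "Suc (r - 1) = r" using assms(2,3) by auto
  then show ?thesis using assms(1) unfolding monotone_path_def by metis
qed

lemma increasing_chain_rectangle:
  assumes "monotone_path m s t"
  shows "increasing_chain m (rectangle s t)"
  unfolding increasing_chain_def
proof (intro conjI ballI)
  fix r assume r: "r \<in> {1..m}"
  show "rectangle s t (r - 1) \<subseteq> rectangle s t r"
  proof (cases "r = 1")
    case False
    then have "s (r - 1) \<le> s r" "t (r - 1) \<le> t r" using monotone_path_step[OF assms r] by auto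
    then show ?thesis by (auto simp: rectangle_def)
  qed (simp add: rectangle_def)
qed (simp add: rectangle_def)

lemma area_mono:
  assumes "monotone_path m s t" "r \<in> {1..m}"
  shows "area s t (r - 1) \<le> area s t r"
proof (cases "r = 1")
  case False
  moreover from this have "r - 1 \<in> {1..m}" using assms(2) by auto
  then have "0 \<le> s r" "0 \<le> t (r - 1)"
    using assms unfolding monotone_path_def by blast+
  ultimately have "s (r - 1) * t (r - 1) \<le> s r * t r"
    using monotone_path_step[OF assms] by (intro mult_mono) auto
  then show ?thesis using False assms(2) by (auto simp: area_def)
qed (use assms in \<open>simp add: area_def monotone_path_def\<close>)

lemma sets_quadrant_borel_iff: "B \<in> sets quadrant_borel \<longleftrightarrow> B \<subseteq> quadrant \<and> B \<in> sets borel"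
proof -
  have "closed quadrant" unfolding quadrant_def by (intro closed_Times) auto
  then show ?thesis by (subst sets_restrict_space_iff) auto
qed

lemma rectangle_sets: "rectangle s t r \<in> sets quadrant_borel"
proof -
  have "closed (rectangle s t r)" unfolding rectangle_def by (auto intro: closed_Times)
  then show ?thesis unfolding sets_quadrant_borel_iff by (auto simp: rectangle_def quadrant_def)
qed

lemma block_rectangle_sets: "block (rectangle s t) r \<in> sets quadrant_borel"
  unfolding block_def by (intro sets.Diff rectangle_sets)

lemma rectangle_eq_cbox: "r \<noteq> 0 \<Longrightarrow> rectangle s t r = cbox (0, 0) (s r, t r)"
  by (simp add: rectangle_def cbox_Pair_eq)

lemma emeasure_rectangle: "emeasure lborel (rectangle s t r) < \<infinity>"
proof (cases "r = 0")
  case False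
  show ?thesis
    unfolding rectangle_eq_cbox[OF False] by (rule emeasure_lborel_cbox_finite)
qed (simp add: rectangle_def)

lemma measure_rectangle:
  assumes "monotone_path m s t" "r \<le> m"
  shows "measure lborel (rectangle s t r) = area s t r"
proof (cases "r = 0")
  case False
  have "measure lborel (cbox (0::real, 0::real) (s r, t r))
      = measure lborel (cbox 0 (s r)) * measure lborel (cbox 0 (t r))"
    by (rule content_Pair)
  then show ?thesis
    using assms False by (simp add: rectangle_eq_cbox area_def monotone_path_def)
qed (simp add: rectangle_def area_def)

lemma measure_block_rectangle:
  assumes "monotone_path m s t" "r \<in> {1..m}"
  shows "measure lborel (block (rectangle s t) r) = area s t r - area s t (r - 1)"
proof -
  have sub: "rectangle s t (r - 1) \<subseteq> rectangle s t r"
    using increasing_chain_rectangle[OF assms(1)] assms(2) by (simp add: increasing_chain_def)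
  have [simp]: "rectangle s t r \<in> sets borel" for r
    using rectangle_sets[of s t r] unfolding sets_quadrant_borel_iff by simp
  have "measure lborel (block (rectangle s t) r)
      = measure lborel (rectangle s t r) - measure lborel (rectangle s t (r - 1))"
    unfolding block_def
    using sub emeasure_rectangle[of s t r] by (intro measure_Diff) auto
  moreover have "r - 1 \<le> m" "r \<le> m" using assms(2) by auto
  ultimately show ?thesis by (simp only: measure_rectangle[OF assms(1)])
qed

lemma emeasure_block_rectangle: "emeasure lborel (block (rectangle s t) r) < \<infinity>"
proof -
  have "rectangle s t r \<in> sets lborel"
    using rectangle_sets[of s t r] unfolding sets_quadrant_borel_iff by simp
  then have "emeasure lborel (block (rectangle s t) r) \<le> emeasure lborel (rectangle s t r)"
    by (intro emeasure_mono) (auto simp: block_def)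
  then show ?thesis using emeasure_rectangle[of s t r] by (rule order.strict_trans1)
qed

context prob_space
begin

lemma poisson_random_fieldD:
  assumes "poisson_random_field lam N"
  shows "lam > 0"
    and "\<And>\<omega>. \<omega> \<in> space M \<Longrightarrow> sets (N \<omega>) = sets quadrant_borel"
    and "\<And>B. B \<in> sets quadrant_borel \<Longrightarrow> (\<lambda>\<omega>. emeasure (N \<omega>) B) \<in> borel_measurable M"
    and "\<And>B n. B \<in> sets quadrant_borel \<Longrightarrow> emeasure lborel B < \<infinity> \<Longrightarrow>
      prob {\<omega>\<in>space M. emeasure (N \<omega>) B = of_nat n}
        = (lam * measure lborel B) ^ n / fact n * exp (- (lam * measure lborel B))"
    and "\<And>(n::nat) B. disjoint_family_on B {1..n} \<Longrightarrow> B ` {1..n} \<subseteq> sets quadrant_borel \<Longrightarrow>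
      indep_vars (\<lambda>_. borel) (\<lambda>i \<omega>. emeasure (N \<omega>) (B i)) {1..n}"
  using assms unfolding poisson_random_field_def by blast+

lemma rect_count_measurable:
  assumes "poisson_random_field lam N" "u \<ge> 0" "v \<ge> 0"
  shows "rect_count N u v \<in> borel_measurable M"
proof -
  have "{0..u} \<times> {0..v} \<in> sets quadrant_borel"
    using rectangle_sets[of "\<lambda>_. u" "\<lambda>_. v" 1] by (simp add: rectangle_def)
  then have "(\<lambda>\<omega>. emeasure (N \<omega>) ({0..u} \<times> {0..v})) \<in> borel_measurable M"
    by (rule poisson_random_fieldD(3)[OF assms(1)])
  then show ?thesis unfolding rect_count_def[abs_def] measure_def by simp
qed

text \<open>
  The masses of the blocks of the rectangle chain are independent Poisson variables, and the mass of
  the \<open>r\<close>-th rectangle is the sum of the first \<open>r\<close> of them. Infinite masses, which \<open>rect_count\<close> turns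
  into 0, occur on a null set only.
\<close>

lemma poisson_random_field_path_law:
  assumes N: "poisson_random_field lam N" and path: "monotone_path m s t"
  shows "has_law (\<lambda>\<omega> r. if r \<in> {1..m} then rect_count N (s r) (t r) \<omega> else 0)
    (conv_family (\<lambda>r. map_pmf (\<lambda>n. tail_vector m r (real n))
       (poisson_law (lam * (area s t r - area s t (r - 1))))) {1..m})"
proof -
  let ?R = "rectangle s t"
  define Y where "Y = (\<lambda>r \<omega>. emeasure (N \<omega>) (block ?R r))"
  define a where "a r = lam * (area s t r - area s t (r - 1))" for r
  note chain = increasing_chain_rectangle[OF path]
  note lam = poisson_random_fieldD(1)[OF N] and setsN = poisson_random_fieldD(2)[OF N]
  have Y_meas: "Y r \<in> borel_measurable M" for r
    unfolding Y_def by (rule poisson_random_fieldD(3)[OF N block_rectangle_sets])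
  have a_nonneg: "a r \<ge> 0" if "r \<in> {1..m}" for r
    using area_mono[OF path that] lam by (simp add: a_def)
  have Y_law: "has_law (Y r) (map_pmf of_nat (poisson_law (a r)))" if r: "r \<in> {1..m}" for r
    unfolding has_law_def
  proof (intro ballI conjI)
    fix x assume "x \<in> set_pmf (map_pmf (of_nat :: nat \<Rightarrow> ennreal) (poisson_law (a r)))"
    then obtain n where x: "x = of_nat n" by auto
    show "{\<omega>\<in>space M. Y r \<omega> = x} \<in> events" using Y_meas by measurable
    have "prob {\<omega>\<in>space M. Y r \<omega> = x} = a r ^ n / fact n * exp (- a r)"
      unfolding x Y_def a_def measure_block_rectangle[OF path r, symmetric]
      by (rule poisson_random_fieldD(4)[OF N block_rectangle_sets emeasure_block_rectangle])
    also have "\<dots> = pmf (map_pmf of_nat (poisson_law (a r))) x"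
      unfolding x using a_nonneg[OF r]
      by (subst pmf_map_inj') (auto simp: pmf_poisson_law inj_on_def)
    finally show "prob {\<omega>\<in>space M. Y r \<omega> = x} = pmf (map_pmf of_nat (poisson_law (a r))) x" .
  qed
  have ind: "indep_vars (\<lambda>_. borel) Y {1..m}"
    unfolding Y_def using block_rectangle_sets[of s t]
    by (intro poisson_random_fieldD(5)[OF N disjoint_block[OF chain]]) auto
  have Y_point: "prob {\<omega>\<in>space M. \<forall>r\<in>{1..m}. Y r \<omega> = c r} = (\<Prod>r\<in>{1..m}. prob {\<omega>\<in>space M. Y r \<omega> = c r})" for c
    using indep_vars_point_prob[OF ind, of "\<lambda>r. {c r}"] by simp
  have "has_law (\<lambda>\<omega>. \<Sum>r\<in>{1..m}. tail_vector m r (enn2real (Y r \<omega>)))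
     (conv_family (\<lambda>r. map_pmf (\<lambda>x. tail_vector m r (enn2real x)) (map_pmf of_nat (poisson_law (a r)))) {1..m})"
  proof (rule has_law_sum_independent[OF finite_atLeastAtMost Y_law Y_point])
    fix x
    have "{\<omega>\<in>space M. (\<lambda>r'. (\<Sum>r\<in>{1..m}. tail_vector m r (enn2real (Y r \<omega>))) r') = x} \<in> events"
      unfolding sum_tail_vector
      using Y_meas by (intro event_function_eq[where m = m]) (auto intro!: borel_measurable_sum)
    then show "{\<omega>\<in>space M. (\<Sum>r\<in>{1..m}. tail_vector m r (enn2real (Y r \<omega>))) = x} \<in> events"
      by simp
  qed
  moreover have "AE \<omega> in M. (\<Sum>r\<in>{1..m}. tail_vector m r (enn2real (Y r \<omega>)))
      = (\<lambda>r. if r \<in> {1..m} then rect_count N (s r) (t r) \<omega> else 0)"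
  proof -
    have "AE \<omega> in M. \<forall>r\<in>{1..m}. Y r \<omega> \<noteq> \<infinity>"
    proof (rule AE_finite_allI)
      fix r assume "r \<in> {1..m}"
      from has_law_AE[OF Y_law[OF this]] show "AE \<omega> in M. Y r \<omega> \<noteq> \<infinity>"
        by eventually_elim (auto simp: of_nat_less_top)
    qed simp
    then show ?thesis
      using AE_space
    proof eventually_elim
      case (elim \<omega>)
      have "rect_count N (s r) (t r) \<omega> = (\<Sum>r'\<in>{1..r}. enn2real (Y r' \<omega>))" if r: "r \<in> {1..m}" for r
      proof -
        have "rect_count N (s r) (t r) \<omega> = measure (N \<omega>) (\<Union>r'\<in>{1..r}. block ?R r')"
          using UN_block[OF chain, of r] r by (simp add: rect_count_def rectangle_def)
        also have "\<dots> = (\<Sum>r'\<in>{1..r}. measure (N \<omega>) (block ?R r'))"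
        proof (rule measure_finite_Union)
          show "disjoint_family_on (block ?R) {1..r}"
            using disjoint_block[OF chain] r by (auto simp: disjoint_family_on_def)
        qed (use elim r setsN block_rectangle_sets[of s t] in \<open>auto simp: Y_def\<close>)
        finally show ?thesis by (simp add: Y_def measure_def)
      qed
      then show ?case unfolding fun_eq_iff sum_tail_vector by auto
    qed
  qed
  ultimately have "has_law (\<lambda>\<omega> r. if r \<in> {1..m} then rect_count N (s r) (t r) \<omega> else 0)
     (conv_family (\<lambda>r. map_pmf (\<lambda>x. tail_vector m r (enn2real x)) (map_pmf of_nat (poisson_law (a r)))) {1..m})"
  proof (rule has_law_cong_AE)
    show "{\<omega>\<in>space M. (\<lambda>r. if r \<in> {1..m} then rect_count N (s r) (t r) \<omega> else 0) = x} \<in> events" for x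
      using path by (intro event_function_eq[where m = m])
        (auto intro!: rect_count_measurable[OF N] simp: monotone_path_def)
  qed
  then show ?thesis by (simp add: map_pmf_comp a_def)
qed

text \<open>
  Independence of the fields for different \<open>j\<close> is independence of processes indexed by the quadrant.
  The path vector of the \<open>j\<close>-th field reads off finitely many coordinates of its process, so fixing the
  value of the vector is a measurable condition on the process.
\<close>

lemma generalized_Skellam_field_path_law:
  assumes S: "generalized_Skellam_field J lam S" and fin: "finite J" and path: "monotone_path m s t"
  shows "has_law (\<lambda>\<omega> r. if r \<in> {1..m} then S (s r) (t r) \<omega> else 0)
    (chain_law J m (\<lambda>j r. lam j * (area s t r - area s t (r - 1))))"
    and "\<And>r. r \<in> {1..m} \<Longrightarrow> S (s r) (t r) \<in> borel_measurable M"
proof -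
  obtain N where N: "\<And>j. j \<in> J \<Longrightarrow> poisson_random_field (lam j) (N j)"
    and ind: "indep_vars (\<lambda>_. \<Pi>\<^sub>M z\<in>quadrant. borel)
            (\<lambda>j \<omega>. \<lambda>z\<in>quadrant. rect_count (N j) (fst z) (snd z) \<omega>) J"
    and S_eq: "\<And>u v \<omega>. u \<ge> 0 \<Longrightarrow> v \<ge> 0 \<Longrightarrow> \<omega> \<in> space M \<Longrightarrow>
      S u v \<omega> = (\<Sum>j\<in>J. j * rect_count (N j) u v \<omega>)"
    using S unfolding generalized_Skellam_field_def by blast
  define Y where "Y j \<omega> = (\<lambda>r. if r \<in> {1..m} then rect_count (N j) (s r) (t r) \<omega> else 0)" for j \<omega>
  have st: "s r \<ge> 0" "t r \<ge> 0" if "r \<in> {1..m}" for r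
    using path that by (auto simp: monotone_path_def)
  show S_meas: "S (s r) (t r) \<in> borel_measurable M" if "r \<in> {1..m}" for r
    using st[OF that] by (subst measurable_cong[OF S_eq])
      (auto intro!: borel_measurable_sum borel_measurable_times rect_count_measurable[OF N])
  have sum_eq: "(\<Sum>j\<in>J. (\<lambda>r. j * Y j \<omega> r)) = (\<lambda>r. if r \<in> {1..m} then S (s r) (t r) \<omega> else 0)"
    if "\<omega> \<in> space M" for \<omega>
    using S_eq[OF st that] that unfolding fun_eq_iff sum_fun_apply by (auto simp: Y_def)
  have ev: "{\<omega>\<in>space M. (\<lambda>r. if r \<in> {1..m} then S (s r) (t r) \<omega> else 0) = x} \<in> events" for x
    by (intro event_function_eq[where m = m]) (auto intro: S_meas)
  have "has_law (\<lambda>\<omega>. \<Sum>j\<in>J. (\<lambda>r. j * Y j \<omega> r))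
     (conv_family (\<lambda>j. map_pmf (\<lambda>y r. j * y r)
       (conv_family (\<lambda>r. map_pmf (\<lambda>n. tail_vector m r (real n))
       (poisson_law (lam j * (area s t r - area s t (r - 1))))) {1..m})) J)"
  proof (rule has_law_sum_independent[OF fin])
    fix j assume "j \<in> J"
    from poisson_random_field_path_law[OF N[OF this] path]
    show "has_law (Y j) (conv_family (\<lambda>r. map_pmf (\<lambda>n. tail_vector m r (real n))
       (poisson_law (lam j * (area s t r - area s t (r - 1))))) {1..m})"
      unfolding Y_def .
  next
    fix c
    let ?P = "\<Pi>\<^sub>M z\<in>quadrant. borel :: real measure"
    let ?F = "\<lambda>j \<omega>. \<lambda>z\<in>quadrant. rect_count (N j) (fst z) (snd z) \<omega>"
    define A where "A j = {z\<in>space ?P. (\<lambda>r. if r \<in> {1..m} then z (s r, t r) else 0) = c j}" for j :: real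
    have A: "A j \<in> sets ?P" for j
      unfolding A_def
      by (intro event_function_eq[where m = m]) (auto intro!: measurable_component_singleton simp: quadrant_def st)
    have mem: "?F j \<omega> \<in> A j \<longleftrightarrow> Y j \<omega> = c j" for j \<omega>
    proof -
      have "?F j \<omega> \<in> space ?P" by (auto simp: space_PiM)
      moreover have "(\<lambda>r. if r \<in> {1..m} then ?F j \<omega> (s r, t r) else 0) = Y j \<omega>"
        using st by (auto simp: fun_eq_iff Y_def quadrant_def)
      ultimately show ?thesis unfolding A_def by simp
    qed
    show "prob {\<omega>\<in>space M. \<forall>j\<in>J. Y j \<omega> = c j} = (\<Prod>j\<in>J. prob {\<omega>\<in>space M. Y j \<omega> = c j})"
      using indep_vars_point_prob[OF ind fin, of A] A by (simp only: mem)
  next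
    show "{\<omega>\<in>space M. (\<Sum>j\<in>J. (\<lambda>r. j * Y j \<omega> r)) = x} \<in> events" for x
      using ev[of x] by (simp add: sum_eq cong: conj_cong)
  qed
  then have "has_law (\<lambda>\<omega> r. if r \<in> {1..m} then S (s r) (t r) \<omega> else 0)
     (conv_family (\<lambda>j. map_pmf (\<lambda>y r. j * y r)
       (conv_family (\<lambda>r. map_pmf (\<lambda>n. tail_vector m r (real n))
       (poisson_law (lam j * (area s t r - area s t (r - 1))))) {1..m})) J)"
    by (rule has_law_cong_AE[OF _ _ ev]) (rule AE_I2, rule sum_eq)
  moreover have "map_pmf (\<lambda>y r. j * y r)
       (conv_family (\<lambda>r. map_pmf (\<lambda>n. tail_vector m r (real n)) (poisson_law (a r))) {1..m})
     = conv_family (\<lambda>r. map_pmf (\<lambda>n. tail_vector m r (j * real n)) (poisson_law (a r))) {1..m}" for j a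
  proof -
    have scale: "(\<lambda>r'. j * tail_vector m r x r') = tail_vector m r (j * x)" for r x
      by (auto simp: tail_vector_def fun_eq_iff)
    show ?thesis
      by (subst map_pmf_conv_family) (auto simp: fun_eq_iff algebra_simps map_pmf_comp scale)
  qed
  ultimately show "has_law (\<lambda>\<omega> r. if r \<in> {1..m} then S (s r) (t r) \<omega> else 0)
    (chain_law J m (\<lambda>j r. lam j * (area s t r - area s t (r - 1))))"
    by (simp add: chain_law_def)
qed

end

section \<open>From total variation to convergence in distribution\<close>

text \<open>
  A continuous function on the product over \<open>{1..m}\<close> extends, through restriction, to a continuous
  function on the full product \<open>nat \<Rightarrow> real\<close>, whose Borel sets are the product sets because the index
  set is countable.
\<close>

lemma borel_measurable_continuous_map_product:
  assumes "continuous_map (product_topology (\<lambda>_. euclideanreal) {1..m}) euclideanreal f"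
  shows "f \<in> borel_measurable (\<Pi>\<^sub>M r\<in>{1..m::nat}. borel)"
proof -
  have "continuous_map (product_topology (\<lambda>_. euclideanreal) UNIV)
          (product_topology (\<lambda>_. euclideanreal) {1..m}) (\<lambda>y. restrict y {1..m})"
    using continuous_map_product_coordinates[of _ UNIV "\<lambda>_. euclideanreal"]
    by (intro continuous_map_coordinatewise_then_product) auto
  from continuous_map_compose[OF this assms]
  have "continuous_on UNIV (\<lambda>y. f (restrict y {1..m}))"
    by (simp add: euclidean_product_topology o_def)
  then have "(\<lambda>y. f (restrict y {1..m})) \<in> borel_measurable borel"
    by (rule borel_measurable_continuous_onI)
  then have 1: "(\<lambda>y. f (restrict y {1..m})) \<in> borel_measurable (\<Pi>\<^sub>M r\<in>UNIV. borel)"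
    by (simp cong: measurable_cong_sets add: sets_PiM_equal_borel)
  have "(\<lambda>x r. if r \<in> {1..m} then x r else 0) \<in> measurable (\<Pi>\<^sub>M r\<in>{1..m}. borel) (\<Pi>\<^sub>M r\<in>UNIV. borel :: real measure)"
  proof (rule measurable_PiM_single')
    fix r :: nat
    show "(\<lambda>x. if r \<in> {1..m} then x r else 0) \<in> borel_measurable (\<Pi>\<^sub>M r\<in>{1..m}. borel :: real measure)"
      by (cases "r \<in> {1..m}") (auto intro: measurable_component_singleton)
  qed auto
  from measurable_compose[OF this 1]
  show ?thesis
  proof (rule iffD1[OF measurable_cong, rotated])
    fix x assume "x \<in> space (\<Pi>\<^sub>M r\<in>{1..m}. borel :: real measure)"
    then have "restrict (\<lambda>r. if r \<in> {1..m} then x r else 0) {1..m} = x"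
      by (auto simp: space_PiM PiE_def extensional_def fun_eq_iff)
    then show "f (restrict (\<lambda>r. if r \<in> {1..m} then x r else 0) {1..m}) = f x" by simp
  qed
qed

lemma (in prob_space) integral_vector_law:
  fixes f :: "(nat \<Rightarrow> real) \<Rightarrow> real"
  assumes law: "has_law (\<lambda>\<omega> r. if r \<in> {1..m} then V r \<omega> else 0) \<mu>"
    and V: "\<And>r. r \<in> {1..m} \<Longrightarrow> V r \<in> borel_measurable M"
    and f: "f \<in> borel_measurable (\<Pi>\<^sub>M r\<in>{1..m::nat}. borel)"
  shows "(\<integral>x. f x \<partial>vector_law m M V) = measure_pmf.expectation \<mu> (\<lambda>y. f (restrict y {1..m}))"
proof -
  have vec: "(\<lambda>\<omega>. \<lambda>r\<in>{1..m}. V r \<omega>) \<in> measurable M (\<Pi>\<^sub>M r\<in>{1..m}. borel)"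
    using V by (rule measurable_restrict)
  have eq: "restrict (\<lambda>r. if r \<in> {1..m} then V r \<omega> else 0) {1..m} = (\<lambda>r\<in>{1..m}. V r \<omega>)" for \<omega>
    by (auto simp: fun_eq_iff)
  have "(\<integral>x. f x \<partial>vector_law m M V) = expectation (\<lambda>\<omega>. f (\<lambda>r\<in>{1..m}. V r \<omega>))"
    unfolding vector_law_def by (rule integral_distr[OF vec f])
  also have "\<dots> = expectation (\<lambda>\<omega>. (\<lambda>y. f (restrict y {1..m})) (\<lambda>r. if r \<in> {1..m} then V r \<omega> else 0))"
    by (simp only: eq)
  also have "\<dots> = measure_pmf.expectation \<mu> (\<lambda>y. f (restrict y {1..m}))"
    using measurable_compose[OF vec f] by (intro has_law_expectation[OF law]) (simp only: eq)
  finally show ?thesis .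
qed

text \<open>
  The integral of a bounded continuous test function only depends on the discrete law, and it is
  continuous for total variation with modulus the supremum of the function.
\<close>

lemma vectors_converge_in_distribution_tv:
  assumes P: "prob_space P" and Q: "prob_space Q"
    and V: "\<And>k r. k \<ge> 1 \<Longrightarrow> r \<in> {1..m} \<Longrightarrow> V k r \<in> borel_measurable P"
    and W: "\<And>r. r \<in> {1..m} \<Longrightarrow> W r \<in> borel_measurable Q"
    and V_law: "\<And>k. k \<ge> 1 \<Longrightarrow> prob_space.has_law P (\<lambda>\<omega> r. if r \<in> {1..m} then V k r \<omega> else 0) (\<mu> k)"
    and W_law: "prob_space.has_law Q (\<lambda>\<omega> r. if r \<in> {1..m} then W r \<omega> else 0) \<nu>"
    and tv: "\<And>k. k \<ge> 1 \<Longrightarrow> tv_close (\<epsilon> k) (\<mu> k) \<nu>" and \<epsilon>: "\<epsilon> \<longlonglongrightarrow> 0"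
  shows "vectors_converge_in_distribution m P V Q W"
  unfolding vectors_converge_in_distribution_def weakly_converges_def
proof (intro allI impI, elim conjE)
  fix f :: "(nat \<Rightarrow> real) \<Rightarrow> real"
  let ?T = "product_topology (\<lambda>_. euclideanreal) {1..m}"
  assume cont: "continuous_map ?T euclideanreal f" and "bounded (f ` topspace ?T)"
  then obtain C where C: "C > 0" "\<And>x. x \<in> topspace ?T \<Longrightarrow> \<bar>f x\<bar> \<le> C"
    unfolding bounded_pos by auto
  note f = borel_measurable_continuous_map_product[OF cont]
  let ?g = "\<lambda>y. f (restrict y {1..m})"
  have g: "\<bar>?g y\<bar> \<le> C" for y
    by (intro C(2)) auto
  have P_eq: "(\<integral>x. f x \<partial>vector_law m P (V k)) = measure_pmf.expectation (\<mu> k) ?g" if "k \<ge> 1" for k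
    by (rule prob_space.integral_vector_law[OF P V_law[OF that] V[OF that] f])
  have Q_eq: "(\<integral>x. f x \<partial>vector_law m Q W) = measure_pmf.expectation \<nu> ?g"
    by (rule prob_space.integral_vector_law[OF Q W_law W f])
  have bound: "\<bar>(\<integral>x. f x \<partial>vector_law m P (V k)) - (\<integral>x. f x \<partial>vector_law m Q W)\<bar> \<le> C * \<epsilon> k"
    if k: "k \<ge> 1" for k
  proof -
    have "\<bar>measure_pmf.expectation (\<mu> k) (\<lambda>y. ?g y / C) - measure_pmf.expectation \<nu> (\<lambda>y. ?g y / C)\<bar> \<le> \<epsilon> k"
      using g C(1) by (intro tv[OF k, unfolded tv_close_def, rule_format]) simp
    then have "\<bar>measure_pmf.expectation (\<mu> k) ?g - measure_pmf.expectation \<nu> ?g\<bar> / C \<le> \<epsilon> k"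
      using C(1) by (simp flip: diff_divide_distrib)
    then show ?thesis using C(1) by (simp add: P_eq[OF k] Q_eq field_simps)
  qed
  have "(\<lambda>k. (\<integral>x. f x \<partial>vector_law m P (V k)) - (\<integral>x. f x \<partial>vector_law m Q W)) \<longlonglongrightarrow> 0"
  proof (rule Lim_null_comparison)
    show "\<forall>\<^sub>F k in sequentially. norm ((\<integral>x. f x \<partial>vector_law m P (V k)) - (\<integral>x. f x \<partial>vector_law m Q W)) \<le> C * \<epsilon> k"
      using bound by (intro eventually_sequentiallyI[of 1]) auto
    show "(\<lambda>k. C * \<epsilon> k) \<longlonglongrightarrow> 0" using tendsto_mult_right_zero[OF \<epsilon>] by simp
  qed
  then show "(\<lambda>k. \<integral>x. f x \<partial>vector_law m P (V k)) \<longlonglongrightarrow> (\<integral>x. f x \<partial>vector_law m Q W)"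
    by (rule LIM_zero_cancel)
qed

section \<open>The array along a monotone path\<close>

definition jump_pmf :: "real set \<Rightarrow> (real \<Rightarrow> real) \<Rightarrow> real pmf" where
  "jump_pmf J w = embed_pmf (\<lambda>x. if x \<in> J then w x else if x = 0 then 1 - sum w J else 0)"

lemma jump_pmf:
  assumes "finite J" "0 \<notin> J" "\<And>j. j \<in> J \<Longrightarrow> w j \<ge> 0" "sum w J \<le> 1"
  shows "pmf (jump_pmf J w) x = (if x \<in> J then w x else if x = 0 then 1 - sum w J else 0)"
    and "set_pmf (jump_pmf J w) \<subseteq> insert 0 J"
proof -
  let ?f = "\<lambda>x. if x \<in> J then w x else if x = 0 then 1 - sum w J else 0"
  have nonneg: "?f x \<ge> 0" for x using assms by auto
  have "(\<integral>\<^sup>+x. ennreal (?f x) \<partial>count_space UNIV) = (\<Sum>x\<in>insert 0 J. ennreal (?f x))"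
    using assms(1) by (intro nn_integral_count_space') auto
  also have "\<dots> = ennreal (\<Sum>x\<in>insert 0 J. ?f x)"
    using nonneg by (intro sum_ennreal) auto
  also have "(\<Sum>x\<in>insert 0 J. ?f x) = 1"
    using assms(1,2) by simp
  finally have total: "(\<integral>\<^sup>+x. ennreal (?f x) \<partial>count_space UNIV) = 1" by simp
  show "pmf (jump_pmf J w) x = ?f x"
    unfolding jump_pmf_def by (rule pmf_embed_pmf[OF nonneg total])
  show "set_pmf (jump_pmf J w) \<subseteq> insert 0 J"
    unfolding jump_pmf_def set_embed_pmf[OF nonneg total] by auto
qed

definition grid_chain :: "(nat \<Rightarrow> real) \<Rightarrow> (nat \<Rightarrow> real) \<Rightarrow> nat \<Rightarrow> nat \<Rightarrow> (nat \<times> nat) set" where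
  "grid_chain s t k r = (if r = 0 then {} else grid k (s r) (t r))"

lemma increasing_chain_grid_chain:
  assumes "monotone_path m s t"
  shows "increasing_chain m (grid_chain s t k)"
  unfolding increasing_chain_def
proof (intro conjI ballI)
  fix r assume r: "r \<in> {1..m}"
  show "grid_chain s t k (r - 1) \<subseteq> grid_chain s t k r"
  proof (cases "r = 1")
    case False
    then show ?thesis
      using monotone_path_step[OF assms r False] r by (auto simp: grid_chain_def intro: grid_mono[THEN subsetD])
  qed (simp add: grid_chain_def)
qed (simp add: grid_chain_def)

lemma array_field_eq_sum_grid:
  "array_field X k u v \<omega> = (\<Sum>i\<in>grid k u v. X k (fst i) (snd i) \<omega>)"
  by (simp add: array_field_def grid_def sum.cartesian_product case_prod_beta)

lemma (in prob_space) array_field_path_law: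
  fixes X :: "nat \<Rightarrow> nat \<Rightarrow> nat \<Rightarrow> 'a \<Rightarrow> real"
  assumes ind: "indep_vars (\<lambda>_. borel) (\<lambda>(k, l, l'). X k l l') ({1..} \<times> {1..} \<times> {1..})"
    and path: "monotone_path m s t" and k: "k \<ge> 1"
    and law: "\<And>i. i \<in> {1..} \<times> {1..} \<Longrightarrow> has_law (X k (fst i) (snd i)) (\<xi> i)"
  shows "has_law (\<lambda>\<omega> r. if r \<in> {1..m} then array_field X k (s r) (t r) \<omega> else 0)
      (conv_family (\<lambda>i. map_pmf (membership_vector m (grid_chain s t k) i) (\<xi> i)) (grid_chain s t k m))"
    and "\<And>r. array_field X k (s r) (t r) \<in> borel_measurable M"
proof -
  let ?R = "grid_chain s t k"
  let ?X = "\<lambda>i. X k (fst i) (snd i)"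
  note chain = increasing_chain_grid_chain[OF path, of k]
  have sub: "?R r \<subseteq> {1..} \<times> {1..}" for r by (auto simp: grid_chain_def grid_def)
  have fin: "finite (?R r)" for r by (simp add: grid_chain_def finite_grid)
  have "random_variable borel ((\<lambda>(k, l, l'). X k l l') i)" if "i \<in> {1..} \<times> {1..} \<times> {1..}" for i
    using ind that unfolding indep_vars_def by blast
  from this[of "(k, i)" for i] have X_meas: "?X i \<in> borel_measurable M" if "i \<in> {1..} \<times> {1..}" for i
    using that k by (cases i) auto
  show meas: "array_field X k (s r) (t r) \<in> borel_measurable M" for r
    unfolding array_field_eq_sum_grid[abs_def]
    by (intro borel_measurable_sum X_meas) (auto simp: grid_def)
  have sum_eq: "(\<Sum>i\<in>?R m. membership_vector m ?R i (?X i \<omega>))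
      = (\<lambda>r. if r \<in> {1..m} then array_field X k (s r) (t r) \<omega> else 0)" for \<omega>
    unfolding fun_eq_iff sum_membership_vector[OF chain fin]
    by (auto simp: array_field_eq_sum_grid grid_chain_def)
  have "has_law (\<lambda>\<omega>. \<Sum>i\<in>?R m. membership_vector m ?R i (?X i \<omega>))
      (conv_family (\<lambda>i. map_pmf (membership_vector m ?R i) (\<xi> i)) (?R m))"
  proof (rule has_law_sum_independent[OF fin])
    show "has_law (?X i) (\<xi> i)" if "i \<in> ?R m" for i using law sub that by blast
  next
    fix c
    have "indep_vars (\<lambda>_. borel) (\<lambda>(k, l, l'). X k l l') (Pair k ` ?R m)"
      using k sub[of m] by (intro indep_vars_subset[OF ind]) auto
    from indep_vars_point_prob[OF this, of "\<lambda>i. {c (snd i)}"] fin[of m]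
    show "prob {\<omega>\<in>space M. \<forall>i\<in>?R m. ?X i \<omega> = c i} = (\<Prod>i\<in>?R m. prob {\<omega>\<in>space M. ?X i \<omega> = c i})"
      by (simp add: prod.reindex inj_on_def case_prod_beta)
  next
    show "{\<omega>\<in>space M. (\<Sum>i\<in>?R m. membership_vector m ?R i (?X i \<omega>)) = x} \<in> events" for x
      unfolding sum_eq by (intro event_function_eq[where m = m]) (auto intro: meas)
  qed
  then show "has_law (\<lambda>\<omega> r. if r \<in> {1..m} then array_field X k (s r) (t r) \<omega> else 0)
      (conv_family (\<lambda>i. map_pmf (membership_vector m ?R i) (\<xi> i)) (?R m))"
    unfolding sum_eq .
qed

lemma sum_block_grid_chain_tendsto:
  fixes p :: "nat \<Rightarrow> nat \<times> nat \<Rightarrow> real"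
  assumes path: "monotone_path m s t" and r: "r \<in> {1..m}"
    and lim: "\<And>u v. u \<ge> 0 \<Longrightarrow> v \<ge> 0 \<Longrightarrow> (\<lambda>k. \<Sum>i\<in>grid k u v. p k i) \<longlonglongrightarrow> c * u * v"
  shows "(\<lambda>k. \<Sum>i\<in>block (grid_chain s t k) r. p k i) \<longlonglongrightarrow> c * (area s t r - area s t (r - 1))"
proof -
  have conv: "(\<lambda>k. \<Sum>i\<in>grid_chain s t k r'. p k i) \<longlonglongrightarrow> c * area s t r'" if "r' \<le> m" for r'
  proof (cases "r' = 0")
    case False
    then have "s r' \<ge> 0" "t r' \<ge> 0" using path that by (auto simp: monotone_path_def)
    from lim[OF this] False show ?thesis by (simp add: grid_chain_def area_def mult.assoc)
  qed (simp add: grid_chain_def area_def)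
  have "(\<Sum>i\<in>block (grid_chain s t k) r. p k i)
      = (\<Sum>i\<in>grid_chain s t k r. p k i) - (\<Sum>i\<in>grid_chain s t k (r - 1). p k i)" for k
    using increasing_chain_grid_chain[OF path, of k] r unfolding block_def increasing_chain_def
    by (intro sum_diff) (auto simp: grid_chain_def finite_grid)
  moreover have "r - 1 \<le> m" "r \<le> m" using r by auto
  ultimately show ?thesis
    unfolding right_diff_distrib by (auto intro!: tendsto_diff conv)
qed

section \<open>Convergence to the Skellam field\<close>

theorem theorem3p1:
  fixes J :: "real set" and lam :: "real \<Rightarrow> real"
    and P :: "'a measure" and Q :: "'b measure"
    and S :: "real \<Rightarrow> real \<Rightarrow> 'b \<Rightarrow> real"
    and p :: "nat \<Rightarrow> nat \<Rightarrow> nat \<Rightarrow> real \<Rightarrow> real"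
    and X :: "nat \<Rightarrow> nat \<Rightarrow> nat \<Rightarrow> 'a \<Rightarrow> real"
    and m :: nat and s t :: "nat \<Rightarrow> real"
  assumes "finite J" and "0 \<notin> J" and "\<forall>j\<in>J. lam j > 0"
    and "prob_space Q" and "prob_space.generalized_Skellam_field Q J lam S"
    and "\<forall>k\<ge>1. \<forall>l\<ge>1. \<forall>l'\<ge>1. \<forall>j\<in>J. p k l l' j \<in> {0<..<1}"
    and "\<forall>k\<ge>1. \<forall>l\<ge>1. \<forall>l'\<ge>1. (\<Sum>j\<in>J. p k l l' j) < 1"
    and "prob_space P"
    and "prob_space.indep_vars P (\<lambda>_. borel) (\<lambda>(k, l, l'). X k l l') ({1..} \<times> {1..} \<times> {1..})"
    and "\<forall>k\<ge>1. \<forall>l\<ge>1. \<forall>l'\<ge>1. \<forall>j\<in>J. measure P {\<omega>\<in>space P. X k l l' \<omega> = j} = p k l l' j"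
    and "\<forall>k\<ge>1. \<forall>l\<ge>1. \<forall>l'\<ge>1.
           measure P {\<omega>\<in>space P. X k l l' \<omega> = 0} = 1 - (\<Sum>j\<in>J. p k l l' j)"
    and "\<forall>j\<in>J. \<forall>u\<ge>0. \<forall>v\<ge>0.
           (\<lambda>k. \<Sum>l = 1..nat \<lfloor>real k * u\<rfloor>. \<Sum>l' = 1..nat \<lfloor>real k * v\<rfloor>. p k l l' j)
             \<longlonglongrightarrow> lam j * u * v"
    and "\<forall>j\<in>J. (\<lambda>k. Max ((\<lambda>(l, l'). p k l l' j) ` ({1..k} \<times> {1..k}))) \<longlonglongrightarrow> 0"
    and "m \<ge> 1"
    and "\<forall>r\<in>{1..m}. s r \<ge> 0 \<and> t r \<ge> 0"
    and "\<forall>r\<in>{1..<m}. s r \<le> s (Suc r) \<and> t r \<le> t (Suc r)"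
  shows "vectors_converge_in_distribution m
           P (\<lambda>k r. array_field X k (s r) (t r)) Q (\<lambda>r. S (s r) (t r))"
proof -
  interpret P: prob_space P by fact
  interpret Q: prob_space Q by fact
  define w where "w k i j = p k (fst i) (snd i) j" for k i j
  define \<xi> where "\<xi> k i = jump_pmf J (w k i)" for k i
  define q where "q k i = (\<Sum>j\<in>J. w k i j)" for k i
  let ?R = "grid_chain s t"
  define a where "a k j r = (\<Sum>i\<in>block (?R k) r. w k i j)" for k j r
  define b where "b j r = lam j * (area s t r - area s t (r - 1))" for j r
  have path: "monotone_path m s t" using assms(15,16) by (simp add: monotone_path_def)
  note chain = increasing_chain_grid_chain[OF path]
  have w_pos: "w k i j \<ge> 0" if "k \<ge> 1" "i \<in> {1..} \<times> {1..}" "j \<in> J" for k i j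
    using assms(6) that by (cases i) (auto simp: w_def less_imp_le)
  have q_le: "sum (w k i) J \<le> 1" if "k \<ge> 1" "i \<in> {1..} \<times> {1..}" for k i
    using assms(7) that by (cases i) (auto simp: w_def less_imp_le)
  have \<xi>_pmf: "pmf (\<xi> k i) x = (if x \<in> J then w k i x else if x = 0 then 1 - sum (w k i) J else 0)"
    and \<xi>_set: "set_pmf (\<xi> k i) \<subseteq> insert 0 J" if "k \<ge> 1" "i \<in> {1..} \<times> {1..}" for k i x
    unfolding \<xi>_def using jump_pmf[of J "w k i"] assms(1,2) w_pos[OF that] q_le[OF that] by auto
  have X_meas: "X k (fst i) (snd i) \<in> borel_measurable P" if "k \<ge> 1" "i \<in> {1..} \<times> {1..}" for k i
  proof -
    have "(\<lambda>(k, l, l'). X k l l') (k, i) \<in> borel_measurable P"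
      using assms(9) that unfolding P.indep_vars_def by blast
    then show ?thesis by (simp add: case_prod_beta)
  qed
  have X_law: "P.has_law (X k (fst i) (snd i)) (\<xi> k i)" if ki: "k \<ge> 1" "i \<in> {1..} \<times> {1..}" for k i
    unfolding P.has_law_def
  proof (intro ballI conjI)
    fix x assume "x \<in> set_pmf (\<xi> k i)"
    then have "x \<in> J \<or> x = 0" using \<xi>_set[OF ki] by auto
    then show "P.prob {\<omega>\<in>space P. X k (fst i) (snd i) \<omega> = x} = pmf (\<xi> k i) x"
      using assms(2,10,11) ki unfolding \<xi>_pmf[OF ki] by (cases i) (auto simp: w_def)
    show "{\<omega>\<in>space P. X k (fst i) (snd i) \<omega> = x} \<in> P.events"
      using X_meas[OF ki] by measurable
  qed
  have R_sub: "?R k r \<subseteq> {1..} \<times> {1..}" and R_fin: "finite (?R k r)" for k r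
    by (auto simp: grid_chain_def grid_def)
  have w_lim: "(\<lambda>k. \<Sum>i\<in>grid k u v. w k i j) \<longlonglongrightarrow> lam j * u * v" if "j \<in> J" "u \<ge> 0" "v \<ge> 0" for j u v
    using assms(12) that by (simp add: w_def grid_def sum.cartesian_product case_prod_beta)
  have q_lim: "(\<lambda>k. \<Sum>i\<in>grid k u v. q k i) \<longlonglongrightarrow> sum lam J * u * v" if "u \<ge> 0" "v \<ge> 0" for u v
    unfolding q_def sum_distrib_right
    by (subst sum.swap) (intro tendsto_sum w_lim that)
  have a_nonneg: "a k j r \<ge> 0" if "k \<ge> 1" "j \<in> J" for k j r
    unfolding a_def using R_sub[of k r] that by (intro sum_nonneg w_pos) (auto simp: block_def)
  have b_nonneg: "b j r \<ge> 0" if "j \<in> J" "r \<in> {1..m}" for j r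
    using area_mono[OF path that(2)] assms(3) that(1) by (auto simp: b_def less_imp_le)
  \<comment> \<open>The total error is the Le Cam error of the grid plus the error in the Poisson rates.\<close>
  show ?thesis
  proof (rule vectors_converge_in_distribution_tv)
    fix k :: nat assume k: "k \<ge> 1"
    note law = P.array_field_path_law[OF assms(9) path k X_law[OF k]]
    show "array_field X k (s r) (t r) \<in> borel_measurable P" for r by (rule law(2))
    show "P.has_law (\<lambda>\<omega> r. if r \<in> {1..m} then array_field X k (s r) (t r) \<omega> else 0)
        (conv_family (\<lambda>i. map_pmf (membership_vector m (?R k) i) (\<xi> k i)) (?R k m))"
      by (rule law(1))
    have "tv_close (\<Sum>i\<in>?R k m. 2 * (\<Sum>j\<in>J. pmf (\<xi> k i) j)\<^sup>2)
        (conv_family (\<lambda>i. map_pmf (membership_vector m (?R k) i) (\<xi> k i)) (?R k m))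
        (chain_law J m (\<lambda>j r. \<Sum>i\<in>block (?R k) r. pmf (\<xi> k i) j))"
      using R_sub[of k m] by (intro le_cam_chain chain R_fin assms(1,2) \<xi>_set[OF k]) auto
    also have "(\<Sum>i\<in>?R k m. 2 * (\<Sum>j\<in>J. pmf (\<xi> k i) j)\<^sup>2) = 2 * (\<Sum>i\<in>?R k m. (q k i)\<^sup>2)"
      unfolding sum_distrib_left using R_sub[of k m] k
      by (intro sum.cong refl) (auto simp: q_def \<xi>_pmf subset_eq)
    also have "chain_law J m (\<lambda>j r. \<Sum>i\<in>block (?R k) r. pmf (\<xi> k i) j) = chain_law J m (a k)"
      unfolding chain_law_def
    proof (intro conv.cong refl)
      fix j r assume j: "j \<in> J"
      have "(\<Sum>i\<in>block (?R k) r. pmf (\<xi> k i) j) = a k j r"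
        unfolding a_def using R_sub[of k r] k j by (intro sum.cong refl) (auto simp: \<xi>_pmf block_def subset_eq)
      then show "map_pmf (\<lambda>n. tail_vector m r (j * real n)) (poisson_law (\<Sum>i\<in>block (?R k) r. pmf (\<xi> k i) j))
          = map_pmf (\<lambda>n. tail_vector m r (j * real n)) (poisson_law (a k j r))" by simp
    qed
    finally show "tv_close (2 * (\<Sum>i\<in>?R k m. (q k i)\<^sup>2) + (\<Sum>j\<in>J. \<Sum>r\<in>{1..m}. 2 * \<bar>a k j r - b j r\<bar>))
        (conv_family (\<lambda>i. map_pmf (membership_vector m (?R k) i) (\<xi> k i)) (?R k m)) (chain_law J m b)"
      using a_nonneg[OF k] b_nonneg by (elim tv_close_trans) (rule tv_close_chain_law, simp)
  next
    show "Q.has_law (\<lambda>\<omega> r. if r \<in> {1..m} then S (s r) (t r) \<omega> else 0) (chain_law J m b)"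
      unfolding b_def by (rule Q.generalized_Skellam_field_path_law(1)[OF assms(5,1) path])
    show "S (s r) (t r) \<in> borel_measurable Q" if "r \<in> {1..m}" for r
      by (rule Q.generalized_Skellam_field_path_law(2)[OF assms(5,1) path that])
  next
    have "(\<lambda>k. \<Sum>i\<in>?R k m. (q k i)\<^sup>2) \<longlonglongrightarrow> 0"
    proof -
      have "(\<lambda>k. \<Sum>i\<in>grid k (s m) (t m). (q k i)\<^sup>2) \<longlonglongrightarrow> 0"
        using assms(14,15) w_pos
        by (intro sum_squares_grid_tendsto_0[OF _ q_lim]) (auto simp: q_def intro!: sum_nonneg)
      then show ?thesis using assms(14) by (simp add: grid_chain_def)
    qed
    moreover have "(\<lambda>k. a k j r) \<longlonglongrightarrow> b j r" if "j \<in> J" "r \<in> {1..m}" for j r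
      unfolding a_def b_def by (rule sum_block_grid_chain_tendsto[OF path that(2) w_lim[OF that(1)]])
    ultimately have "(\<lambda>k. 2 * (\<Sum>i\<in>?R k m. (q k i)\<^sup>2) + (\<Sum>j\<in>J. \<Sum>r\<in>{1..m}. 2 * \<bar>a k j r - b j r\<bar>))
        \<longlonglongrightarrow> 2 * 0 + (\<Sum>j\<in>J. \<Sum>r\<in>{1..m}. 2 * \<bar>b j r - b j r\<bar>)"
      by (intro tendsto_intros) auto
    then show "(\<lambda>k. 2 * (\<Sum>i\<in>?R k m. (q k i)\<^sup>2) + (\<Sum>j\<in>J. \<Sum>r\<in>{1..m}. 2 * \<bar>a k j r - b j r\<bar>)) \<longlonglongrightarrow> 0"
      by simp
  qed (fact assms(4,8))+
qed

end
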